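(* Let $D$ be the distance from $x_0$ to the set $X_*$ of minimizers of $F$, and let $F_*$ be the optimal value of $F$. Then, for any integer $k\ge 1$, the iterate $y_k$ generated by the optimal tensor method (defined in the context) satisfies $$F(y_k)-F_*\le \left(\frac{d+1}{2}\right)^{\frac{3d+1}{2}}\frac{2^d}{\left(1-(\hat\sigma+\sigma_u)^2\right)^{\frac{d-1}{2}}\,d!\,\sigma_l}\,D^{d+1}(L_d+M)\,k^{-\frac{3d+1}{2}}.$$
   Context: Problem: $\min_{x\in\mathbb{R}^n}F(x)=f(x)+h(x)$, where $d$ is a positive integer, $f:\mathbb{R}^n\to\mathbb{R}$ is convex and $d$ times differentiable with $\|\nabla^d f(x)-\nabla^d f(y)\|\le L_d\|x-y\|$ for all $x,y$ (for a $d$-th order tensor, $\|\mathcal T\|=\max_{\|z^i\|=1}\mathcal T[z^1,\dots,z^d]$), and $h$ is a proper closed convex function, possibly non-smooth. The set $X_*$ of minimizers of $F$ is nonempty. Regularized Taylor model, with parameter $M>0$: $f_x(y)=f(x)+\sum_{\ell=1}^d\frac1{\ell!}\nabla^\ell f(x)[y-x]^\ell+\frac{M}{(d+1)!}\|y-x\|^{d+1}$. $\epsilon$-subdifferential: $\partial_\epsilon h(x)=\{u: h(y)\ge h(x)+\langle y-x,u\rangle-\epsilon\ \forall y\in\mathbb{R}^n\}$. $\hat\sigma$-approximate solution: for $\lambda>0$, $x\in\mathbb{R}^n$, $\hat\sigma\ge0$, a triplet $(y,u,\epsilon)\in\mathbb{R}^n\times\mathbb{R}^n\times\mathbb{R}_+$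 is a $\hat\sigma$-approximate solution at $(\lambda,x)$ (of $\min_y f_x(y)+h(y)+\frac1{2\lambda}\|y-x\|^2$) if $u\in\nabla f_x(y)+\partial_\epsilon h(y)$ and $\|\lambda u+y-x\|^2+2\lambda\epsilon\le\hat\sigma^2\|y-x\|^2$. Optimal tensor method. Step 1: let $x_0=y_0\in\mathbb{R}^n$, $v_0\in\partial f(x_0)$, $\epsilon_0=0$, $A_0=0$, $k=0$, tolerances $0<\bar\epsilon,\bar\rho<1$, $M\ge L_d$, and $\hat\sigma\ge0$, $0<\sigma_l<\sigma_u<1$ such that $\sigma:=\hat\sigma+\sigma_u<1$ and $\sigma_l(1+\hat\sigma)^{d-1}<\sigma_u(1-\hat\sigma)^{d-1}$. Step 2: if $\|v_k\|\le\bar\rho$ and $\epsilon_k\le\bar\epsilon$, stop; else go to Step 3. Step 3: find $\lambda_{k+1}>0$ and a $\hat\sigma$-approximate solution $(y_{k+1},u_{k+1},\epsilon_{k+1})$ at $(\lambda_{k+1},\tilde x_k)$ such that either $$\frac{d!\,\sigma_l}{L_d+M}\le \lambda_{k+1}\|y_{k+1}-\tilde x_k\|^{d-1}\le \frac{d!\,\sigma_u}{L_d+M},$$ or $\|\nabla f(y_{k+1})+u_{k+1}-\nabla f_{\tilde x_k}(y_{k+1})\|\le\bar\rho$ and $\epsilon_{k+1}\le\bar\epsilon$ hold, where $\tilde x_k=\frac{A_k}{A_k+a_{k+1}}y_k+\frac{a_{k+1}}{A_k+a_{k+1}}x_k$ and $a_{k+1}=\frac{\lambda_{k+1}+\sqrt{\lambda_{k+1}^2+4\lambda_{k+1}A_k}}{2}$.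 Step 4: set $v_{k+1}=\nabla f(y_{k+1})+u_{k+1}-\nabla f_{\tilde x_k}(y_{k+1})$, $A_{k+1}=A_k+a_{k+1}$, $x_{k+1}=x_k-a_{k+1}v_{k+1}$, replace $k$ by $k+1$ and go to Step 2.
   Formalization: The bound is proved for y_k under the added assumption that iterate k satisfies the two-sided inequality on λ_k‖y_k − x̃_{k−1}‖^{d−1} of Step 3; a final iterate accepted only through the stopping alternative is excluded, since the bound can fail there. *)

theory Defs
  imports "HOL-Analysis.Analysis"
begin

subsection \<open>Derivatives and tensors\<close>

text \<open>
  \<open>deriv_tensor f [z\<^sub>1, \<dots>, z\<^sub>l] x\<close> is the derivative tensor of order \<open>l\<close> of \<open>f\<close> at \<open>x\<close> applied to
  \<open>z\<^sub>1, \<dots>, z\<^sub>l\<close>. The list is consumed from the inside out (\<open>z\<^sub>l\<close> is the first direction of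
  differentiation), which is immaterial as the tensors of an \<open>l\<close> times (Frechet) differentiable
  function are symmetric.
\<close>

primrec deriv_tensor :: "('a::euclidean_space \<Rightarrow> real) \<Rightarrow> 'a list \<Rightarrow> 'a \<Rightarrow> real" where
  "deriv_tensor f [] = f"
| "deriv_tensor f (z # zs) = (\<lambda>x. frechet_derivative (deriv_tensor f zs) (at x) z)"

text \<open>
  On a finite-dimensional space the tensor-valued map of order \<open>l\<close> is (Frechet) differentiable iff
  all its evaluations at fixed directions are; so this is ordinary \<open>d\<close>-fold differentiability.
\<close>

definition times_differentiable :: "nat \<Rightarrow> ('a::euclidean_space \<Rightarrow> real) \<Rightarrow> bool" where
  "times_differentiable d f \<longleftrightarrow>
     (\<forall>zs x. length zs < d \<longrightarrow> deriv_tensor f zs differentiable (at x))"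

text \<open>
  A tensor of order \<open>d\<close> is represented by its values on lists of \<open>d\<close> vectors. For multilinear \<open>T\<close>
  the supremum is over a nonempty bounded set and is a maximum.
\<close>

definition tensor_norm :: "nat \<Rightarrow> ('a::euclidean_space list \<Rightarrow> real) \<Rightarrow> real" where
  "tensor_norm d T = (SUP zs \<in> {zs. length zs = d \<and> (\<forall>z \<in> set zs. norm z = 1)}. T zs)"

definition grad :: "('a::euclidean_space \<Rightarrow> real) \<Rightarrow> 'a \<Rightarrow> 'a" where
  "grad g x = (THE D. GDERIV g x :> D)"

definition taylor_model ::
    "('a::euclidean_space \<Rightarrow> real) \<Rightarrow> nat \<Rightarrow> real \<Rightarrow> 'a \<Rightarrow> 'a \<Rightarrow> real" where
  "taylor_model f d M x y =
     f x + (\<Sum>l = 1..d. 1 / fact l * deriv_tensor f (replicate l (y - x)) x)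
     + M / fact (d + 1) * norm (y - x) ^ (d + 1)"

subsection \<open>Extended-valued convex functions\<close>

definition ereal_epigraph :: "('a \<Rightarrow> ereal) \<Rightarrow> ('a \<times> real) set" where
  "ereal_epigraph h = {(x, r). h x \<le> ereal r}"

definition proper_closed_convex :: "('a::euclidean_space \<Rightarrow> ereal) \<Rightarrow> bool" where
  "proper_closed_convex h \<longleftrightarrow>
     (\<forall>x. h x \<noteq> -\<infinity>) \<and> (\<exists>x. h x \<noteq> \<infinity>) \<and>
     closed (ereal_epigraph h) \<and> convex (ereal_epigraph h)"

definition eps_subdifferential ::
    "('a::euclidean_space \<Rightarrow> ereal) \<Rightarrow> real \<Rightarrow> 'a \<Rightarrow> 'a set" where
  "eps_subdifferential h e x = {u. \<forall>y. h y \<ge> h x + ereal ((y - x) \<bullet> u) - ereal e}"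

definition objective ::
    "('a \<Rightarrow> real) \<Rightarrow> ('a \<Rightarrow> ereal) \<Rightarrow> 'a \<Rightarrow> ereal" where
  "objective f h x = ereal (f x) + h x"

definition minimizers :: "('a \<Rightarrow> ereal) \<Rightarrow> 'a set" where
  "minimizers F = {x. \<forall>y. F x \<le> F y}"

subsection \<open>The optimal tensor method\<close>

definition approx_solution ::
    "('a::euclidean_space \<Rightarrow> real) \<Rightarrow> ('a \<Rightarrow> ereal) \<Rightarrow> nat \<Rightarrow> real \<Rightarrow> real \<Rightarrow>
     real \<Rightarrow> 'a \<Rightarrow> 'a \<times> 'a \<times> real \<Rightarrow> bool" where
  "approx_solution f h d M \<sigma> lam x = (\<lambda>(y, u, e).
     0 \<le> e \<and>
     u \<in> (\<lambda>w. grad (taylor_model f d M x) y + w) ` eps_subdifferential h e y \<and>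
     (norm (lam *\<^sub>R u + y - x))\<^sup>2 + 2 * lam * e \<le> \<sigma>\<^sup>2 * (norm (y - x))\<^sup>2)"

text \<open>For \<open>d = 1\<close> the power \<open>0 ^ 0 = 1\<close> makes this a condition on \<open>lam\<close> alone.\<close>

definition large_step ::
    "nat \<Rightarrow> real \<Rightarrow> real \<Rightarrow> real \<Rightarrow> real \<Rightarrow> real \<Rightarrow> 'a::euclidean_space \<Rightarrow> 'a \<Rightarrow> bool" where
  "large_step d L M \<sigma>\<^sub>l \<sigma>\<^sub>u lam x y \<longleftrightarrow>
     fact d * \<sigma>\<^sub>l / (L + M) \<le> lam * norm (y - x) ^ (d - 1) \<and>
     lam * norm (y - x) ^ (d - 1) \<le> fact d * \<sigma>\<^sub>u / (L + M)"

text \<open>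
  The sequences record a run of the method that performs (at least) \<open>K\<close> iterations: the stopping
  test of Step 2 fails at \<open>0, \<dots>, K - 1\<close>, and Steps 3 and 4 produce the iterates \<open>1, \<dots>, K\<close>.
  Whether the method stops at \<open>K\<close> is left open, and later entries of the sequences are
  unconstrained. The point \<open>xt k\<close> is the extrapolated point from which iterate \<open>Suc k\<close> is computed.
\<close>

definition optimal_tensor_method_run ::
    "('a::euclidean_space \<Rightarrow> real) \<Rightarrow> ('a \<Rightarrow> ereal) \<Rightarrow> nat \<Rightarrow> real \<Rightarrow> real \<Rightarrow>
     real \<Rightarrow> real \<Rightarrow> real \<Rightarrow> real \<Rightarrow> real \<Rightarrow>
     (nat \<Rightarrow> 'a) \<Rightarrow> (nat \<Rightarrow> 'a) \<Rightarrow> (nat \<Rightarrow> 'a) \<Rightarrow> (nat \<Rightarrow> 'a) \<Rightarrow> (nat \<Rightarrow> 'a) \<Rightarrow>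
     (nat \<Rightarrow> real) \<Rightarrow> (nat \<Rightarrow> real) \<Rightarrow> (nat \<Rightarrow> real) \<Rightarrow> (nat \<Rightarrow> real) \<Rightarrow> nat \<Rightarrow> bool" where
  "optimal_tensor_method_run f h d L M \<sigma> \<sigma>\<^sub>l \<sigma>\<^sub>u rho_bar eps_bar x y u v xt eps lam a A K \<longleftrightarrow>
     y 0 = x 0 \<and> v 0 \<in> eps_subdifferential (\<lambda>z. ereal (f z)) 0 (x 0) \<and> eps 0 = 0 \<and> A 0 = 0 \<and>
     (\<forall>k < K.
        \<not> (norm (v k) \<le> rho_bar \<and> eps k \<le> eps_bar) \<and>
        lam (Suc k) > 0 \<and>
        a (Suc k) = (lam (Suc k) + sqrt ((lam (Suc k))\<^sup>2 + 4 * lam (Suc k) * A k)) / 2 \<and>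
        xt k = (A k / (A k + a (Suc k))) *\<^sub>R y k + (a (Suc k) / (A k + a (Suc k))) *\<^sub>R x k \<and>
        approx_solution f h d M \<sigma> (lam (Suc k)) (xt k) (y (Suc k), u (Suc k), eps (Suc k)) \<and>
        (large_step d L M \<sigma>\<^sub>l \<sigma>\<^sub>u (lam (Suc k)) (xt k) (y (Suc k)) \<or>
         norm (grad f (y (Suc k)) + u (Suc k) - grad (taylor_model f d M (xt k)) (y (Suc k)))
           \<le> rho_bar \<and> eps (Suc k) \<le> eps_bar) \<and>
        v (Suc k) = grad f (y (Suc k)) + u (Suc k) - grad (taylor_model f d M (xt k)) (y (Suc k)) \<and>
        A (Suc k) = A k + a (Suc k) \<and>
        x (Suc k) = x k - a (Suc k) *\<^sub>R v (Suc k))"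

end

theory Submission
  imports Defs
begin

text \<open>
  Since the \<open>d\<close>-th derivative of \<open>f\<close> is \<open>L\<close>-Lipschitz, the gradients of \<open>f\<close> and of its regularized Taylor
  model at \<open>x\<close> differ at \<open>y\<close> by at most \<open>(L + M) / d! * |y - x|^d\<close>. The upper large-step condition
  turns this into \<open>\<sigma>\<^sub>u |y - x| / \<lambda>\<close>, so every iteration is an inexact proximal step on \<open>F\<close> with
  relative error \<open>s = \<sigma> + \<sigma>\<^sub>u < 1\<close>. For such steps
  \<open>A\<^sub>k (F y\<^sub>k - F z) + |x\<^sub>k - z|^2 / 2 + (1 - s^2) / 2 * (\<Sum>j\<le>k. A\<^sub>j / \<lambda>\<^sub>j * |y\<^sub>j - xt\<^sub>j\<^sub>-\<^sub>1|^2)\<close> is nonincreasing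
  in \<open>k\<close>, which bounds both the gap by \<open>D^2 / (2 A\<^sub>k)\<close> and the weighted sum by \<open>D^2 / (1 - s^2)\<close>.

  It remains to bound \<open>A\<^sub>k\<close> from below. The recursion for \<open>a\<close> gives \<open>\<Sum>j\<le>k. sqrt \<lambda>\<^sub>j \<le> 2 sqrt A\<^sub>k\<close>. By the
  lower large-step condition and Hoelder's inequality with \<open>\<theta> = (d - 1) / (3 d + 1)\<close>, the two sums
  together yield \<open>C * (\<Sum>j\<le>k. A\<^sub>j powr \<theta>) \<le> A\<^sub>k powr ((1 - \<theta>) / 2)\<close>, which forces growth of order
  \<open>k powr ((3 d + 1) / 2)\<close>.
\<close>

subsection \<open>Multilinear forms on lists of vectors\<close>

text \<open>The condition concerns lists of length \<open>l\<close> only, because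
  \<open>deriv_tensor f\<close> is a single function on lists of every length. The shape
  \<open>as @ z # bs\<close> singles out a slot without indexing.\<close>

definition multilinear_form :: "nat \<Rightarrow> ('a::real_vector list \<Rightarrow> real) \<Rightarrow> bool" where
  "multilinear_form l T \<longleftrightarrow>
     (\<forall>as bs. Suc (length as + length bs) = l \<longrightarrow> linear (\<lambda>z. T (as @ z # bs)))"

lemma multilinear_form_Cons:
  assumes "multilinear_form (Suc l) T"
  shows "multilinear_form l (\<lambda>zs. T (z # zs))"
  unfolding multilinear_form_def
proof (intro allI impI)
  fix as bs :: "'a list"
  assume "Suc (length as + length bs) = l"
  then have "linear (\<lambda>w. T ((z # as) @ w # bs))"
    using assms unfolding multilinear_form_def by (metis add_Suc length_Cons)
  then show "linear (\<lambda>w. T (z # as @ w # bs))"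
    by simp
qed

lemma multilinear_form_linear_hd:
  assumes "multilinear_form (Suc l) T" "length zs = l"
  shows "linear (\<lambda>z. T (z # zs))"
  using assms(1)[unfolded multilinear_form_def, rule_format, of "[]" zs] assms(2) by simp

lemma multilinear_form_diff:
  assumes "multilinear_form l S" "multilinear_form l T"
  shows "multilinear_form l (\<lambda>zs. S zs - T zs)"
  using assms unfolding multilinear_form_def by (auto intro: linear_compose_sub)

lemma multilinear_form_expand_hd:
  fixes T :: "'a::euclidean_space list \<Rightarrow> real"
  assumes "multilinear_form (Suc l) T" "length zs = l"
  shows "T (z # zs) = (\<Sum>b\<in>Basis. (z \<bullet> b) * T (b # zs))"
proof -
  interpret linear "\<lambda>z. T (z # zs)"
    by (rule multilinear_form_linear_hd[OF assms])
  have "T (z # zs) = T ((\<Sum>b\<in>Basis. (z \<bullet> b) *\<^sub>R b) # zs)"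
    by (simp add: euclidean_representation)
  also have "\<dots> = (\<Sum>b\<in>Basis. (z \<bullet> b) * T (b # zs))"
    by (simp add: sum scaleR)
  finally show ?thesis .
qed

text \<open>Homogeneity pulls the norm out of each slot. As \<open>sgn 0 = 0\<close>, the
  factorization \<open>z = norm z *\<^sub>R sgn z\<close> covers zero vectors too.\<close>

lemma multilinear_form_sgn:
  fixes T :: "'a::real_normed_vector list \<Rightarrow> real"
  assumes "multilinear_form (length zs) T"
  shows "T zs = prod_list (map norm zs) * T (map sgn zs)"
  using assms
proof (induction zs arbitrary: T)
  case (Cons z zs)
  interpret linear "\<lambda>z. T (z # zs)"
    by (rule multilinear_form_linear_hd[where l = "length zs"]) (use Cons.prems in auto)
  have "T (z # zs) = T ((norm z *\<^sub>R sgn z) # zs)"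
    by (cases "z = 0") (simp_all add: sgn_div_norm)
  also have "\<dots> = norm z * T (sgn z # zs)"
    by (simp only: scaleR real_scaleR_def)
  also have "T (sgn z # zs) = prod_list (map norm zs) * T (sgn z # map sgn zs)"
    using Cons.prems by (intro Cons.IH multilinear_form_Cons) auto
  finally show ?case by simp
qed simp

text \<open>Expanding the first slot in the basis lowers the order by one, and coordinates are at
  most the norm. This makes the set in \<open>tensor_norm\<close> bounded above, so that its
  supremum really is an upper bound.\<close>

lemma multilinear_form_bounded:
  fixes T :: "'a::euclidean_space list \<Rightarrow> real"
  assumes "multilinear_form l T"
  shows "\<exists>B. \<forall>zs. length zs = l \<longrightarrow> \<bar>T zs\<bar> \<le> B * prod_list (map norm zs)"
  using assms
proof (induction l arbitrary: T)
  case 0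
  then show ?case by (intro exI[of _ "\<bar>T []\<bar>"]) auto
next
  case (Suc l)
  have "\<forall>b. \<exists>B. \<forall>zs. length zs = l \<longrightarrow> \<bar>T (b # zs)\<bar> \<le> B * prod_list (map norm zs)"
    using Suc.IH[OF multilinear_form_Cons[OF Suc.prems]] by blast
  then obtain B where B: "\<And>b zs. length zs = l \<Longrightarrow> \<bar>T (b # zs)\<bar> \<le> B b * prod_list (map norm zs)"
    by metis
  have "\<bar>T zs\<bar> \<le> (\<Sum>b\<in>Basis. B b) * prod_list (map norm zs)" if "length zs = Suc l" for zs
  proof -
    obtain w ws where zs: "zs = w # ws" and ws: "length ws = l"
      using \<open>length zs = Suc l\<close> by (cases zs) auto
    have "\<bar>T zs\<bar> \<le> (\<Sum>b\<in>Basis. \<bar>(w \<bullet> b) * T (b # ws)\<bar>)"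
      unfolding zs by (subst multilinear_form_expand_hd[OF Suc.prems ws]) (rule sum_abs)
    also have "\<dots> \<le> (\<Sum>b\<in>Basis. norm w * (B b * prod_list (map norm ws)))"
      by (intro sum_mono) (auto simp: abs_mult intro!: mult_mono B ws Basis_le_norm)
    also have "\<dots> = (\<Sum>b\<in>Basis. B b) * prod_list (map norm zs)"
      by (simp add: zs sum_distrib_left sum_distrib_right mult_ac)
    finally show ?thesis .
  qed
  then show ?case by blast
qed

text \<open>Rescaling nonzero entries yields a list of unit vectors. The supremum is taken over
  signed values; negating one unit vector, available as \<open>d \<ge> 1\<close>, turns it into a
  bound on the absolute value.\<close>

lemma tensor_norm_bound:
  fixes T :: "'a::euclidean_space list \<Rightarrow> real"
  assumes T: "multilinear_form d T" and d: "d \<ge> 1" and zs: "length zs = d"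
  shows "\<bar>T zs\<bar> \<le> tensor_norm d T * prod_list (map norm zs)"
proof (cases "0 \<in> set zs")
  case True
  then have "prod_list (map norm zs) = 0"
    by (induction zs) auto
  then show ?thesis
    using multilinear_form_sgn[of zs T] T zs by simp
next
  case False
  define U where "U = {zs :: 'a list. length zs = d \<and> (\<forall>z \<in> set zs. norm z = 1)}"
  have one: "prod_list (map norm zs) = 1" if "\<forall>z \<in> set zs. norm z = 1" for zs :: "'a list"
    using that by (induction zs) auto
  obtain B where B: "\<And>zs. length zs = d \<Longrightarrow> \<bar>T zs\<bar> \<le> B * prod_list (map norm zs)"
    using multilinear_form_bounded[OF T] by blast
  have "T zs \<le> B" if "zs \<in> U" for zs
    using B[of zs] one[of zs] that unfolding U_def by auto
  then have "bdd_above (T ` U)"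
    by (auto intro!: bdd_aboveI2)
  then have le: "T zs \<le> tensor_norm d T" if "zs \<in> U" for zs
    using that unfolding tensor_norm_def U_def by (intro cSUP_upper) auto
  have abs_le: "\<bar>T zs\<bar> \<le> tensor_norm d T" if "zs \<in> U" for zs
  proof -
    obtain w ws where zs: "zs = w # ws"
      using d \<open>zs \<in> U\<close> by (cases zs) (auto simp: U_def)
    have "linear (\<lambda>z. T (z # ws))"
      using T \<open>zs \<in> U\<close> zs by (intro multilinear_form_linear_hd[of "length ws"]) (auto simp: U_def)
    then have "T (- w # ws) = - T zs"
      unfolding zs by (rule linear_neg)
    moreover have "- w # ws \<in> U"
      using \<open>zs \<in> U\<close> zs by (auto simp: U_def)
    ultimately show ?thesis
      using le[of zs] le[of "- w # ws"] \<open>zs \<in> U\<close> by simp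
  qed
  have "map sgn zs \<in> U"
    using False zs by (auto simp: U_def norm_sgn)
  moreover have "prod_list (map norm zs) \<ge> 0"
    by (rule prod_list_nonneg) auto
  ultimately show ?thesis
    using multilinear_form_sgn[of zs T] T zs mult_left_mono[OF abs_le[of "map sgn zs"]]
    by (simp add: abs_mult mult.commute[of "tensor_norm d T"])
qed

text \<open>This is the product rule: each slot is differentiated once. Expanding the first slot in
  the basis splits off the linear factor \<open>w \<bullet> b\<close> and leaves forms of lower
  order.\<close>

lemma multilinear_form_diagonal_has_derivative:
  fixes T :: "'a::euclidean_space list \<Rightarrow> real"
  assumes "multilinear_form l T"
  shows "((\<lambda>w. T (replicate l w)) has_derivative
           (\<lambda>z. \<Sum>i<l. T (replicate i w @ z # replicate (l - Suc i) w))) (at w)"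
  using assms
proof (induction l arbitrary: T)
  case (Suc l)
  let ?D = "\<lambda>b z. \<Sum>i<l. T (b # replicate i w @ z # replicate (l - Suc i) w)"
  have expand: "T (z # zs) = (\<Sum>b\<in>Basis. (z \<bullet> b) * T (b # zs))" if "length zs = l" for z zs
    using multilinear_form_expand_hd[OF Suc.prems that] .
  have "((\<lambda>w. \<Sum>b\<in>Basis. (w \<bullet> b) * T (b # replicate l w)) has_derivative
         (\<lambda>z. \<Sum>b\<in>Basis. (w \<bullet> b) * ?D b z + (z \<bullet> b) * T (b # replicate l w))) (at w)"
    using Suc.IH[OF multilinear_form_Cons[OF Suc.prems]]
    by (auto intro!: derivative_eq_intros)
  moreover have "(\<Sum>b\<in>Basis. (w \<bullet> b) * ?D b z + (z \<bullet> b) * T (b # replicate l w))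
      = (\<Sum>i<Suc l. T (replicate i w @ z # replicate (Suc l - Suc i) w))" for z
  proof -
    \<comment> \<open>Undoes the basis expansion inside each summand. The remaining terms
      \<open>z \<bullet> b\<close> recombine to the summand \<open>i = 0\<close>, hence the shifted
      sum below.\<close>
    have "(\<Sum>b\<in>Basis. (w \<bullet> b) * ?D b z) = ?D w z"
      by (subst sum.swap[of _ Basis, symmetric] | simp add: sum_distrib_left)+
         (intro sum.cong refl, subst expand[of _ w], auto)
    then show ?thesis
      by (subst sum.lessThan_Suc_shift) (simp add: sum.distrib expand[of _ z, symmetric])
  qed
  moreover have "T (replicate (Suc l) w) = (\<Sum>b\<in>Basis. (w \<bullet> b) * T (b # replicate l w))" for w
    using expand[of "replicate l w" w] by simp
  ultimately show ?case
    by (simp only:)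
qed simp

subsection \<open>Gradients, mixed derivatives and Taylor remainders\<close>

text \<open>The Riesz representer \<open>D\<close> of the derivative exists in finite dimension and
  is unique, so the description defining \<open>grad\<close> is well defined.\<close>

lemma grad_inner:
  fixes g :: "'a::euclidean_space \<Rightarrow> real"
  assumes "(g has_derivative g') (at x)"
  shows "grad g x \<bullet> z = g' z"
proof -
  interpret bounded_linear g'
    using assms by (rule has_derivative_bounded_linear)
  define D where "D = (\<Sum>b\<in>Basis. g' b *\<^sub>R b)"
  have D: "z \<bullet> D = g' z" for z
  proof -
    have "z \<bullet> D = (\<Sum>b\<in>Basis. (z \<bullet> b) * g' b)"
      unfolding D_def by (simp add: inner_sum_right mult.commute)
    also have "\<dots> = g' (\<Sum>b\<in>Basis. (z \<bullet> b) *\<^sub>R b)"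
      by (simp add: sum scaleR)
    finally show ?thesis by (simp add: euclidean_representation)
  qed
  have "grad g x = D"
    unfolding grad_def
  proof (rule the_equality)
    show "GDERIV g x :> D"
      using assms by (simp add: gderiv_def D)
    fix E assume "GDERIV g x :> E"
    then have "(\<lambda>h. h \<bullet> E) = g'"
      using assms has_derivative_unique unfolding gderiv_def by blast
    then show "E = D"
      using D by (metis vector_eq_rdot inner_commute)
  qed
  then show ?thesis
    using D[of z] by (simp add: inner_commute)
qed

text \<open>Restricting \<open>f\<close> to the line through \<open>y\<close> and \<open>z\<close>
  reduces this to the tangent inequality for convex functions of one real variable.\<close>

lemma convex_on_imp_above_tangent_hyperplane:
  fixes f :: "'a::euclidean_space \<Rightarrow> real"
  assumes convex: "convex_on UNIV f" and f': "(f has_derivative f') (at y)"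
  shows "f y + f' (z - y) \<le> f z"
proof -
  let ?p = "\<lambda>t. y + t *\<^sub>R (z - y)"
  have "convex_on UNIV (\<lambda>t. f (?p t))"
  proof (rule convex_onI)
    fix t s r :: real assume "0 < t" "t < 1"
    moreover have "?p ((1 - t) *\<^sub>R s + t *\<^sub>R r) = (1 - t) *\<^sub>R ?p s + t *\<^sub>R ?p r"
      by (simp add: algebra_simps)
    ultimately show "f (?p ((1 - t) *\<^sub>R s + t *\<^sub>R r)) \<le> (1 - t) * f (?p s) + t * f (?p r)"
      using convex_onD[OF convex, of t "?p s" "?p r"] by simp
  qed auto
  moreover have "((\<lambda>t. f (?p t)) has_real_derivative f' (z - y)) (at 0)"
  proof -
    interpret bounded_linear f'
      using f' by (rule has_derivative_bounded_linear)
    have "(f has_derivative f') (at (?p 0))"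
      using f' by simp
    then have "((\<lambda>t. f (?p t)) has_derivative (\<lambda>t. f' (t *\<^sub>R (z - y)))) (at 0)"
      by (rule has_derivative_compose[rotated]) (auto intro!: derivative_eq_intros)
    then show ?thesis
      by (simp add: has_field_derivative_def scaleR mult_commute_abs)
  qed
  ultimately have "f (?p 1) - f (?p 0) \<ge> f' (z - y) * (1 - 0)"
    by (intro convex_on_imp_above_tangent[of UNIV]) auto
  then show ?thesis by simp
qed

section \<open>Symmetry of mixed second derivatives\<close>

text \<open>
  The second difference is symmetric in \<open>a\<close> and \<open>b\<close> up to rearrangement, so that applying this twice
  yields Schwarz's theorem.
\<close>

lemma second_difference_mean_value:
  fixes g :: "'a::real_normed_vector \<Rightarrow> real"
  assumes g': "\<And>x. (g has_derivative g' x) (at x)"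
    and g'': "\<And>x. ((\<lambda>x. g' x a) has_derivative g'' x) (at x)"
    and s: "s > 0"
  shows "\<exists>p. norm (p - x) \<le> s * (norm a + norm b) \<and>
    g (x + s *\<^sub>R b + s *\<^sub>R a) - g (x + s *\<^sub>R a) - (g (x + s *\<^sub>R b) - g x) = s\<^sup>2 * g'' p b"
proof -
  have line: "((\<lambda>t. G (q + t *\<^sub>R c)) has_real_derivative G' (q + t *\<^sub>R c) c) (at t)"
    if "\<And>x. (G has_derivative G' x) (at x)" for G :: "'a \<Rightarrow> real" and G' q c t
  proof -
    interpret bounded_linear "G' (q + t *\<^sub>R c)"
      using that by (rule has_derivative_bounded_linear)
    have "((\<lambda>t. G (q + t *\<^sub>R c)) has_derivative (\<lambda>h. G' (q + t *\<^sub>R c) (h *\<^sub>R c))) (at t)"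
      by (rule has_derivative_compose[OF _ that]) (auto intro!: derivative_eq_intros)
    then show ?thesis
      by (simp add: has_field_derivative_def scaleR mult_commute_abs)
  qed
  \<comment> \<open>Two applications of the mean value theorem: along \<open>a\<close> to the
    increment in direction \<open>b\<close>, then along \<open>b\<close> to the resulting difference
    of first derivatives.\<close>
  let ?\<phi> = "\<lambda>t. g (x + s *\<^sub>R b + t *\<^sub>R a) - g (x + t *\<^sub>R a)"
  obtain t where t: "0 < t" "t < s"
    "?\<phi> s - ?\<phi> 0 = (s - 0) * (g' (x + s *\<^sub>R b + t *\<^sub>R a) a - g' (x + t *\<^sub>R a) a)"
    using MVT2[OF s, of ?\<phi> "\<lambda>t. g' (x + s *\<^sub>R b + t *\<^sub>R a) a - g' (x + t *\<^sub>R a) a"]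
      DERIV_diff[OF line[OF g'] line[OF g']] by blast
  obtain r where r: "0 < r" "r < s"
    "g' (x + t *\<^sub>R a + s *\<^sub>R b) a - g' (x + t *\<^sub>R a + 0 *\<^sub>R b) a = (s - 0) * g'' (x + t *\<^sub>R a + r *\<^sub>R b) b"
    using MVT2[OF s, of "\<lambda>r. g' (x + t *\<^sub>R a + r *\<^sub>R b) a"
      "\<lambda>r. g'' (x + t *\<^sub>R a + r *\<^sub>R b) b"] line[OF g''] by blast
  have "norm (t *\<^sub>R a + r *\<^sub>R b) \<le> t * norm a + r * norm b"
    using t r by (intro norm_triangle_le) simp
  also have "\<dots> \<le> s * norm a + s * norm b"
    using t r by (intro add_mono mult_right_mono) auto
  finally have "norm (x + t *\<^sub>R a + r *\<^sub>R b - x) \<le> s * (norm a + norm b)"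
    by (simp add: algebra_simps)
  moreover have swap: "x + s *\<^sub>R b + t *\<^sub>R a = x + t *\<^sub>R a + s *\<^sub>R b"
    by simp
  have "g (x + s *\<^sub>R b + s *\<^sub>R a) - g (x + s *\<^sub>R a) - (g (x + s *\<^sub>R b) - g x)
      = s\<^sup>2 * g'' (x + t *\<^sub>R a + r *\<^sub>R b) b"
    using t(3)[unfolded swap] r(3) by (simp add: power2_eq_square)
  ultimately show ?thesis
    by blast
qed

text \<open>Both orders of differentiation evaluate the same second difference, at points
  \<open>p n\<close> and \<open>q n\<close> that approach \<open>x\<close> as \<open>s n\<close>
  tends to 0. Continuity at \<open>x\<close> then identifies the limits.\<close>

lemma mixed_derivatives_commute:
  fixes g :: "'a::real_normed_vector \<Rightarrow> real"
  assumes g': "\<And>x. (g has_derivative g' x) (at x)"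
    and ga: "\<And>x. ((\<lambda>x. g' x a) has_derivative ga x) (at x)"
    and gb: "\<And>x. ((\<lambda>x. g' x b) has_derivative gb x) (at x)"
    and cont: "isCont (\<lambda>x. ga x b) x" "isCont (\<lambda>x. gb x a) x"
  shows "ga x b = gb x a"
proof -
  define s :: "nat \<Rightarrow> real" where "s n = inverse (real (Suc n))" for n
  have s: "s n > 0" for n
    by (simp add: s_def)
  have s_lim: "(\<lambda>n. s n * c) \<longlonglongrightarrow> 0" for c
    unfolding s_def using tendsto_mult_left_zero[OF LIMSEQ_inverse_real_of_nat] by blast
  have "\<forall>n. \<exists>p q. norm (p - x) \<le> s n * (norm a + norm b) \<and> norm (q - x) \<le> s n * (norm b + norm a) \<and>
      (s n)\<^sup>2 * ga p b = (s n)\<^sup>2 * gb q a"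
  proof
    fix n
    let ?\<Delta> = "g (x + s n *\<^sub>R b + s n *\<^sub>R a) - g (x + s n *\<^sub>R a) - (g (x + s n *\<^sub>R b) - g x)"
    obtain p where p: "norm (p - x) \<le> s n * (norm a + norm b)" "?\<Delta> = (s n)\<^sup>2 * ga p b"
      using second_difference_mean_value[OF g' ga s[of n], of x b] by blast
    obtain q where q: "norm (q - x) \<le> s n * (norm b + norm a)"
      "g (x + s n *\<^sub>R a + s n *\<^sub>R b) - g (x + s n *\<^sub>R b) - (g (x + s n *\<^sub>R a) - g x) = (s n)\<^sup>2 * gb q a"
      using second_difference_mean_value[OF g' gb s[of n], of x a] by blast
    have "x + s n *\<^sub>R a + s n *\<^sub>R b = x + s n *\<^sub>R b + s n *\<^sub>R a"
      by simp
    from q(2)[unfolded this] have "(s n)\<^sup>2 * ga p b = (s n)\<^sup>2 * gb q a"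
      using p(2) by linarith
    with p(1) q(1) show "\<exists>p q. norm (p - x) \<le> s n * (norm a + norm b) \<and>
        norm (q - x) \<le> s n * (norm b + norm a) \<and> (s n)\<^sup>2 * ga p b = (s n)\<^sup>2 * gb q a"
      by blast
  qed
  then obtain p q where p: "\<And>n. norm (p n - x) \<le> s n * (norm a + norm b)"
    and q: "\<And>n. norm (q n - x) \<le> s n * (norm b + norm a)"
    and pq: "\<And>n. (s n)\<^sup>2 * ga (p n) b = (s n)\<^sup>2 * gb (q n) a"
    by metis
  have "p \<longlonglongrightarrow> x"
    by (rule LIM_zero_cancel, rule Lim_null_comparison[OF _ s_lim[of "norm a + norm b"]]) (use p in auto)
  then have "(\<lambda>n. ga (p n) b) \<longlonglongrightarrow> ga x b"
    using cont(1) by (rule isCont_tendsto_compose[rotated])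
  moreover have "q \<longlonglongrightarrow> x"
    by (rule LIM_zero_cancel, rule Lim_null_comparison[OF _ s_lim[of "norm b + norm a"]]) (use q in auto)
  then have "(\<lambda>n. gb (q n) a) \<longlonglongrightarrow> gb x a"
    using cont(2) by (rule isCont_tendsto_compose[rotated])
  moreover have "ga (p n) b = gb (q n) a" for n
    using pq[of n] s[of n] by simp
  ultimately show ?thesis
    using LIMSEQ_unique by auto
qed

text \<open>Here \<open>q i\<close> is the \<open>i\<close>-th derivative of \<open>q 0\<close>. The
  remainder has as its derivative the remainder of the shifted family, which the induction
  hypothesis bounds.\<close>

lemma taylor_remainder_lipschitz:
  fixes q :: "nat \<Rightarrow> real \<Rightarrow> real"
  assumes "\<And>i t. i < m \<Longrightarrow> (q i has_real_derivative q (Suc i) t) (at t)"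
    and "\<And>t. t \<ge> 0 \<Longrightarrow> \<bar>q m t - q m 0\<bar> \<le> C * t"
    and "t \<ge> 0"
  shows "\<bar>q 0 t - (\<Sum>l\<le>m. q l 0 * t ^ l / fact l)\<bar> \<le> C * t ^ Suc m / fact (Suc m)"
  using assms
proof (induction m arbitrary: q t)
  case 0
  then show ?case by simp
next
  case (Suc m)
  define r where "r t = q 0 t - (\<Sum>l\<le>Suc m. q l 0 * t ^ l / fact l)" for t
  define r' where "r' t = q (Suc 0) t - (\<Sum>l\<le>m. q (Suc l) 0 * t ^ l / fact l)" for t
  have r'_le: "\<bar>r' t\<bar> \<le> C * t ^ Suc m / fact (Suc m)" if "t \<ge> 0" for t
    unfolding r'_def using Suc.prems that by (intro Suc.IH[of "\<lambda>i. q (Suc i)"]) auto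
  have power: "((\<lambda>t. c * t ^ Suc l / fact (Suc l)) has_real_derivative c * t ^ l / fact l) (at t)"
    for c t :: real and l
  proof -
    have "((\<lambda>t. c / fact (Suc l) * t ^ Suc l) has_real_derivative
        c / fact (Suc l) * (real (Suc l) * t ^ (Suc l - Suc 0))) (at t)"
      by (intro DERIV_cmult DERIV_pow)
    moreover have "c / fact (Suc l) * (real (Suc l) * t ^ (Suc l - Suc 0)) = c * t ^ l / fact l"
      by (simp add: fact_Suc del: of_nat_Suc)
    ultimately show ?thesis
      by simp
  qed
  have r': "(r has_real_derivative r' t) (at t)" for t
  proof -
    have "r = (\<lambda>t. q 0 t - (q 0 0 + (\<Sum>l\<le>m. q (Suc l) 0 * t ^ Suc l / fact (Suc l))))"
      unfolding r_def sum.atMost_Suc_shift by simp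
    moreover have "((\<lambda>t. q 0 t - (q 0 0 + (\<Sum>l\<le>m. q (Suc l) 0 * t ^ Suc l / fact (Suc l))))
        has_real_derivative q (Suc 0) t - (0 + (\<Sum>l\<le>m. q (Suc l) 0 * t ^ l / fact l))) (at t)"
      using Suc.prems(1)[of 0] by (intro DERIV_diff DERIV_add DERIV_const DERIV_sum power) auto
    ultimately show ?thesis
      by (simp add: r'_def)
  qed
  have "r 0 = 0"
    unfolding r_def sum.atMost_Suc_shift by simp
  \<comment> \<open>The derivative of \<open>?B\<close> is the inductive bound on \<open>r'\<close>,
    so \<open>?B - r\<close> and \<open>?B + r\<close> are both nondecreasing from their value 0 at
    the origin. This takes the place of integration.\<close>
  let ?B = "\<lambda>t. C * t ^ Suc (Suc m) / fact (Suc (Suc m))"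
  have "?B 0 - r 0 \<le> ?B t - r t"
  proof (rule DERIV_nonneg_imp_nondecreasing[OF \<open>t \<ge> 0\<close>])
    fix s :: real assume "0 \<le> s"
    have "((\<lambda>t. ?B t - r t) has_real_derivative C * s ^ Suc m / fact (Suc m) - r' s) (at s)"
      by (rule DERIV_diff[OF power r'])
    moreover have "0 \<le> C * s ^ Suc m / fact (Suc m) - r' s"
      using r'_le[OF \<open>0 \<le> s\<close>] by linarith
    ultimately show "\<exists>y. ((\<lambda>t. ?B t - r t) has_real_derivative y) (at s) \<and> 0 \<le> y"
      by blast
  qed
  moreover have "?B 0 + r 0 \<le> ?B t + r t"
  proof (rule DERIV_nonneg_imp_nondecreasing[OF \<open>t \<ge> 0\<close>])
    fix s :: real assume "0 \<le> s"
    have "((\<lambda>t. ?B t + r t) has_real_derivative C * s ^ Suc m / fact (Suc m) + r' s) (at s)"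
      by (rule DERIV_add[OF power r'])
    moreover have "0 \<le> C * s ^ Suc m / fact (Suc m) + r' s"
      using r'_le[OF \<open>0 \<le> s\<close>] by linarith
    ultimately show "\<exists>y. ((\<lambda>t. ?B t + r t) has_real_derivative y) (at s) \<and> 0 \<le> y"
      by blast
  qed
  ultimately have "\<bar>r t\<bar> \<le> ?B t"
    using \<open>r 0 = 0\<close> by simp
  then show ?case by (simp only: r_def)
qed

text \<open>The origin is included, since the Taylor model is also differentiated at its centre;
  there the difference quotient is \<open>norm h ^ m\<close>, which vanishes in the limit because
  \<open>m \<ge> 1\<close>.\<close>

lemma norm_power_has_derivative:
  fixes w :: "'a::real_inner"
  assumes "m \<ge> 1"
  shows "((\<lambda>w. norm w ^ Suc m) has_derivative (\<lambda>z. real (Suc m) * norm w ^ m * (z \<bullet> sgn w))) (at w)"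
proof (cases "w = 0")
  case True
  have "((\<lambda>h::'a. norm h ^ m) \<longlongrightarrow> norm (0::'a) ^ m) (at 0)"
    by (intro tendsto_intros)
  then have "((\<lambda>h::'a. norm h ^ m) \<longlongrightarrow> 0) (at 0)"
    using assms by (simp add: power_0_left)
  then have "((\<lambda>h::'a. norm (norm h ^ Suc m) / norm h) \<longlongrightarrow> 0) (at 0)"
    by (rule Lim_transform_eventually) (auto simp: eventually_at_filter)
  then show ?thesis
    using True assms by (simp add: has_derivative_at power_0_left)
next
  case False
  have "((\<lambda>w. norm w ^ Suc m) has_derivative (\<lambda>z. of_nat (Suc m) * (z \<bullet> sgn w) * norm w ^ (Suc m - 1))) (at w)"
    by (intro has_derivative_power has_derivative_norm False)
  then show ?thesis by (simp add: mult_ac del: of_nat_Suc)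
qed

subsection \<open>Functions with Lipschitz continuous highest derivative\<close>

lemma deriv_tensor_has_derivative:
  assumes "times_differentiable d f" "length zs < d"
  shows "(deriv_tensor f zs has_derivative (\<lambda>z. deriv_tensor f (z # zs) x)) (at x)"
  using assms frechet_derivative_works[of "deriv_tensor f zs" "at x"]
  unfolding times_differentiable_def by auto

lemma deriv_tensor_line:
  assumes "times_differentiable d f" "length zs < d"
  shows "((\<lambda>t. deriv_tensor f zs (x + t *\<^sub>R w)) has_real_derivative
    deriv_tensor f (w # zs) (x + t *\<^sub>R w)) (at t)"
proof -
  interpret bounded_linear "\<lambda>z. deriv_tensor f (z # zs) (x + t *\<^sub>R w)"
    using deriv_tensor_has_derivative[OF assms] by (rule has_derivative_bounded_linear)
  have "((\<lambda>t. deriv_tensor f zs (x + t *\<^sub>R w)) has_derivative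
      (\<lambda>h. deriv_tensor f ((h *\<^sub>R w) # zs) (x + t *\<^sub>R w))) (at t)"
    by (rule has_derivative_compose[OF _ deriv_tensor_has_derivative[OF assms]])
      (auto intro!: derivative_eq_intros)
  then show ?thesis
    unfolding has_field_derivative_def scaleR by (simp add: mult_commute_abs)
qed

text \<open>Prepended entries differentiate in the base point, so the equality is assumed at every
  point and not only at \<open>x\<close>.\<close>

lemma deriv_tensor_append_cong:
  assumes "\<And>x. deriv_tensor f bs x = deriv_tensor f cs x"
  shows "deriv_tensor f (as @ bs) x = deriv_tensor f (as @ cs) x"
proof -
  have "deriv_tensor f bs = deriv_tensor f cs"
    using assms by blast
  then have "deriv_tensor f (as @ bs) = deriv_tensor f (as @ cs)"
    by (induction as) simp_all
  then show ?thesis by simp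
qed

text \<open>The outermost slot is linear because a derivative is. For an inner slot, linearity is an
  identity between functions of \<open>x\<close>; differentiating it and using uniqueness of
  derivatives carries it through each entry of \<open>as\<close>.\<close>

lemma multilinear_form_deriv_tensor:
  assumes f: "times_differentiable d f" and "l \<le> d"
  shows "multilinear_form l (\<lambda>zs. deriv_tensor f zs x)"
proof -
  have "linear (\<lambda>z. deriv_tensor f (as @ z # bs) x)" if "length as + length bs < d" for as bs x
    using that
  proof (induction as arbitrary: x)
    case Nil
    then show ?case
      using has_derivative_linear[OF deriv_tensor_has_derivative[OF f]] by simp
  next
    case (Cons a as)
    have IH: "linear (\<lambda>z. deriv_tensor f (as @ z # bs) x)" for x
      using Cons by simp
    have D: "(deriv_tensor f (as @ z # bs) has_derivative
        (\<lambda>w. deriv_tensor f (w # as @ z # bs) x)) (at x)" for z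
      using Cons.prems by (intro deriv_tensor_has_derivative[OF f]) simp
    show ?case
    proof (rule linearI)
      fix z w
      have "deriv_tensor f (as @ (z + w) # bs) =
          (\<lambda>x. deriv_tensor f (as @ z # bs) x + deriv_tensor f (as @ w # bs) x)"
        using linear_add[OF IH] by blast
      then have "(\<lambda>c. deriv_tensor f (c # as @ (z + w) # bs) x) =
          (\<lambda>c. deriv_tensor f (c # as @ z # bs) x + deriv_tensor f (c # as @ w # bs) x)"
        using has_derivative_unique[OF D[of "z + w"]] has_derivative_add[OF D[of z] D[of w]]
        by simp
      then show "deriv_tensor f ((a # as) @ (z + w) # bs) x =
          deriv_tensor f ((a # as) @ z # bs) x + deriv_tensor f ((a # as) @ w # bs) x"
        by (metis append_Cons)
    next
      fix r z
      have "deriv_tensor f (as @ (r *\<^sub>R z) # bs) = (\<lambda>x. r *\<^sub>R deriv_tensor f (as @ z # bs) x)"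
        using linear_scale[OF IH] by blast
      then have "(\<lambda>c. deriv_tensor f (c # as @ (r *\<^sub>R z) # bs) x) =
          (\<lambda>c. r *\<^sub>R deriv_tensor f (c # as @ z # bs) x)"
        using has_derivative_unique[OF D[of "r *\<^sub>R z"]] has_derivative_scaleR_right[OF D[of z], of r]
        by simp
      then show "deriv_tensor f ((a # as) @ (r *\<^sub>R z) # bs) x = r *\<^sub>R deriv_tensor f ((a # as) @ z # bs) x"
        by (metis append_Cons)
    qed
  qed
  then show ?thesis
    using \<open>l \<le> d\<close> unfolding multilinear_form_def by auto
qed

locale lipschitz_derivative =
  fixes f :: "'a::euclidean_space \<Rightarrow> real" and d :: nat and L :: real
  assumes d: "d \<ge> 1" and diff: "times_differentiable d f"
    and lipschitz: "tensor_norm d (\<lambda>zs. deriv_tensor f zs z - deriv_tensor f zs w) \<le> L * norm (z - w)"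
begin

lemma deriv_tensor_diff_le:
  assumes "length zs = d"
  shows "\<bar>deriv_tensor f zs x - deriv_tensor f zs y\<bar> \<le> L * norm (x - y) * prod_list (map norm zs)"
proof -
  have "multilinear_form d (\<lambda>zs. deriv_tensor f zs x - deriv_tensor f zs y)"
    by (intro multilinear_form_diff multilinear_form_deriv_tensor[OF diff]) auto
  from tensor_norm_bound[OF this d assms]
  have "\<bar>deriv_tensor f zs x - deriv_tensor f zs y\<bar> \<le>
      tensor_norm d (\<lambda>zs. deriv_tensor f zs x - deriv_tensor f zs y) * prod_list (map norm zs)" .
  also have "\<dots> \<le> L * norm (x - y) * prod_list (map norm zs)"
    by (intro mult_right_mono lipschitz prod_list_nonneg) auto
  finally show ?thesis .
qed

text \<open>Follows from comparing the tensors at two points at distance 1, along unit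
  directions.\<close>

lemma lipschitz_constant_nonneg: "L \<ge> 0"
proof -
  obtain b :: 'a where b: "b \<in> Basis"
    using nonempty_Basis by blast
  have "0 \<le> \<bar>deriv_tensor f (replicate d b) b - deriv_tensor f (replicate d b) 0\<bar>"
    by simp
  also have "\<dots> \<le> L"
    using deriv_tensor_diff_le[of "replicate d b" b 0] b by (simp add: prod_list_replicate)
  finally show ?thesis .
qed

text \<open>Differentiability gives continuity below order \<open>d\<close>; at order
  \<open>d\<close> it comes from the Lipschitz condition. The top order is what makes Schwarz's
  theorem applicable to all tensors up to order \<open>d\<close>.\<close>

lemma deriv_tensor_continuous:
  assumes "length zs \<le> d"
  shows "isCont (deriv_tensor f zs) x"
proof (cases "length zs = d")
  case True
  have "((\<lambda>y. L * norm (y - x) * prod_list (map norm zs)) \<longlongrightarrow> L * norm (x - x) * prod_list (map norm zs)) (at x)"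
    by (intro tendsto_intros)
  then have "((\<lambda>y. L * norm (y - x) * prod_list (map norm zs)) \<longlongrightarrow> 0) (at x)"
    by simp
  then have "((\<lambda>y. deriv_tensor f zs y - deriv_tensor f zs x) \<longlongrightarrow> 0) (at x)"
    by (rule Lim_null_comparison[rotated])
      (intro always_eventually allI, unfold real_norm_def, rule deriv_tensor_diff_le[OF True])
  then show ?thesis
    unfolding isCont_def by (rule LIM_zero_cancel)
next
  case False
  then show ?thesis
    using assms deriv_tensor_has_derivative[OF diff, of zs x] has_derivative_continuous by fastforce
qed

lemma deriv_tensor_swap:
  assumes "length zs + 2 \<le> d"
  shows "deriv_tensor f (a # b # zs) x = deriv_tensor f (b # a # zs) x"
proof -
  have D: "(deriv_tensor f ws has_derivative (\<lambda>z. deriv_tensor f (z # ws) x)) (at x)"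
    if "length ws < d" for ws x
    by (rule deriv_tensor_has_derivative[OF diff that])
  show ?thesis
    by (rule mixed_derivatives_commute[where g = "deriv_tensor f zs"
          and g' = "\<lambda>x z. deriv_tensor f (z # zs) x"
          and ga = "\<lambda>x z. deriv_tensor f (z # b # zs) x"
          and gb = "\<lambda>x z. deriv_tensor f (z # a # zs) x"])
       (use assms in \<open>auto intro!: D deriv_tensor_continuous simp del: deriv_tensor.simps\<close>)
qed

text \<open>Adjacent swaps move \<open>z\<close> to the end, where it is the first direction of
  differentiation. The entries \<open>w\<close> then differentiate \<open>deriv_tensor f [z]\<close>
  along a line.\<close>

lemma deriv_tensor_rotate:
  assumes "Suc (i + j) \<le> d"
  shows "deriv_tensor f (replicate i w @ z # replicate j w) x = deriv_tensor f (replicate (i + j) w @ [z]) x"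
proof -
  have "deriv_tensor f (z # replicate j w) x = deriv_tensor f (replicate j w @ [z]) x" if "Suc j \<le> d" for x
    using that
  proof (induction j arbitrary: x)
    case (Suc j)
    have "deriv_tensor f (z # w # replicate j w) x = deriv_tensor f (w # z # replicate j w) x"
      using Suc.prems by (intro deriv_tensor_swap) simp
    also have "\<dots> = deriv_tensor f ([w] @ (replicate j w @ [z])) x"
      using deriv_tensor_append_cong[of f "z # replicate j w" "replicate j w @ [z]" "[w]"] Suc by simp
    finally show ?case by simp
  qed simp
  then show ?thesis
    using deriv_tensor_append_cong[of f "z # replicate j w" "replicate j w @ [z]" "replicate i w"] assms
    by (simp add: replicate_add)
qed

text \<open>One-dimensional Taylor expansion of the derivative in direction \<open>z\<close> along
  the segment from \<open>x\<close> to \<open>x + w\<close>.\<close>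

lemma taylor_derivative_remainder:
  "\<bar>deriv_tensor f [z] (x + w) - (\<Sum>l<d. deriv_tensor f (replicate l w @ [z]) x / fact l)\<bar>
    \<le> L * norm w ^ d * norm z / fact d"
proof -
  \<comment> \<open>One derivative is already spent on \<open>z\<close>, so the expansion stops at
    order \<open>d - 1\<close>.\<close>
  define m where "m = d - 1"
  have m: "d = Suc m"
    using d by (simp add: m_def)
  define q where "q i t = deriv_tensor f (replicate i w @ [z]) (x + t *\<^sub>R w)" for i t
  have q: "q i = (\<lambda>t. deriv_tensor f (replicate i w @ [z]) (x + t *\<^sub>R w))" for i
    by (simp add: fun_eq_iff q_def)
  have "\<bar>q 0 1 - (\<Sum>l\<le>m. q l 0 * 1 ^ l / fact l)\<bar> \<le> (L * norm w ^ d * norm z) * 1 ^ Suc m / fact (Suc m)"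
  proof (rule taylor_remainder_lipschitz)
    fix i t assume "i < m"
    then show "(q i has_real_derivative q (Suc i) t) (at t)"
      using deriv_tensor_line[OF diff, of "replicate i w @ [z]"] m
      by (simp add: q del: deriv_tensor.simps)
  next
    fix t :: real assume "t \<ge> 0"
    then show "\<bar>q m t - q m 0\<bar> \<le> L * norm w ^ d * norm z * t"
      using deriv_tensor_diff_le[of "replicate m w @ [z]" "x + t *\<^sub>R w" x]
      by (simp add: q_def m prod_list_replicate mult_ac)
  qed simp
  then show ?thesis
    by (simp add: q_def m lessThan_Suc_atMost)
qed

text \<open>By symmetry the \<open>l\<close> slots of the term of order \<open>l\<close> contribute
  equally, and \<open>l / l! = 1 / (l - 1)!\<close>. What appears is the Taylor polynomial of degree
  \<open>d - 1\<close> of the derivative of \<open>f\<close>.\<close>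

lemma taylor_model_has_derivative:
  "(taylor_model f d M x has_derivative
     (\<lambda>z. (\<Sum>l<d. deriv_tensor f (replicate l (y - x) @ [z]) x / fact l)
       + M / fact d * norm (y - x) ^ d * (z \<bullet> sgn (y - x)))) (at y)"
proof -
  let ?w = "y - x"
  let ?T = "\<lambda>zs. deriv_tensor f zs x"
  have shift: "((\<lambda>y. G (y - x)) has_derivative G') (at y)" if "(G has_derivative G') (at ?w)"
    for G :: "'a \<Rightarrow> real" and G'
  proof -
    have "((\<lambda>y. y - x) has_derivative (\<lambda>h. h)) (at y)"
      by (auto intro!: derivative_eq_intros)
    from has_derivative_compose[OF this that] show ?thesis .
  qed
  have 1: "((\<lambda>y. 1 / fact l * ?T (replicate l (y - x))) has_derivative
      (\<lambda>z. 1 / fact l * (\<Sum>i<l. ?T (replicate i ?w @ z # replicate (l - Suc i) ?w)))) (at y)"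
    if "l \<in> {1..d}" for l
    using that
    by (intro has_derivative_mult_right shift multilinear_form_diagonal_has_derivative
        multilinear_form_deriv_tensor[OF diff]) auto
  have 2: "1 / fact l * (\<Sum>i<l. ?T (replicate i ?w @ z # replicate (l - Suc i) ?w))
      = ?T (replicate (l - 1) ?w @ [z]) / fact (l - 1)" if l: "l \<in> {1..d}" for l z
  proof -
    have "(\<Sum>i<l. ?T (replicate i ?w @ z # replicate (l - Suc i) ?w)) = (\<Sum>i<l. ?T (replicate (l - 1) ?w @ [z]))"
      using l by (intro sum.cong refl) (subst deriv_tensor_rotate, auto)
    moreover have "(fact l :: real) = real l * fact (l - 1)"
      using l by (intro fact_reduce) simp
    ultimately show ?thesis
      using l by simp
  qed
  have 3: "((\<lambda>y. M / fact (d + 1) * norm (y - x) ^ (d + 1)) has_derivative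
      (\<lambda>z. M / fact d * norm ?w ^ d * (z \<bullet> sgn ?w))) (at y)"
  proof -
    have "((\<lambda>y. M / fact (d + 1) * norm (y - x) ^ Suc d) has_derivative
        (\<lambda>z. M / fact (d + 1) * (real (Suc d) * norm ?w ^ d * (z \<bullet> sgn ?w)))) (at y)"
      by (intro has_derivative_mult_right shift[where G = "\<lambda>w. norm w ^ Suc d"] norm_power_has_derivative d)
    then show ?thesis
      by (simp add: fact_Suc mult.assoc del: of_nat_Suc)
  qed
  have "(taylor_model f d M x has_derivative
      (\<lambda>z. 0 + (\<Sum>l=1..d. 1 / fact l * (\<Sum>i<l. ?T (replicate i ?w @ z # replicate (l - Suc i) ?w)))
        + M / fact d * norm ?w ^ d * (z \<bullet> sgn ?w))) (at y)"
    unfolding taylor_model_def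
    by (intro has_derivative_add has_derivative_const has_derivative_sum 1 3)
  moreover have "(\<Sum>l=1..d. 1 / fact l * (\<Sum>i<l. ?T (replicate i ?w @ z # replicate (l - Suc i) ?w)))
      = (\<Sum>l<d. ?T (replicate l ?w @ [z]) / fact l)" for z
  proof -
    have "(\<Sum>l=1..d. 1 / fact l * (\<Sum>i<l. ?T (replicate i ?w @ z # replicate (l - Suc i) ?w)))
        = (\<Sum>l=1..d. ?T (replicate (l - 1) ?w @ [z]) / fact (l - 1))"
      by (intro sum.cong refl 2)
    also have "\<dots> = (\<Sum>l<d. ?T (replicate l ?w @ [z]) / fact l)"
      by (rule sum.reindex_bij_witness[of _ Suc "\<lambda>l. l - 1"]) auto
    finally show ?thesis .
  qed
  ultimately show ?thesis
    by (simp only: add_0)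
qed

text \<open>Testing the difference of the gradients against itself bounds
  \<open>(norm v)\<^sup>2\<close> by a multiple of \<open>norm v\<close>, which is then
  cancelled.\<close>

lemma grad_taylor_model_error:
  assumes "M \<ge> 0"
  shows "norm (grad f y - grad (taylor_model f d M x) y) \<le> (L + M) / fact d * norm (y - x) ^ d"
proof -
  define v where "v = grad f y - grad (taylor_model f d M x) y"
  let ?w = "y - x"
  let ?S = "\<Sum>l<d. deriv_tensor f (replicate l ?w @ [v]) x / fact l"
  have "grad f y \<bullet> v = deriv_tensor f [v] y"
    using deriv_tensor_has_derivative[OF diff, of "[]" y] d by (intro grad_inner) (simp del: deriv_tensor.simps(2))
  moreover have "grad (taylor_model f d M x) y \<bullet> v = ?S + M / fact d * norm ?w ^ d * (v \<bullet> sgn ?w)"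
    by (rule grad_inner[OF taylor_model_has_derivative])
  ultimately have "(norm v)\<^sup>2 = deriv_tensor f [v] y - ?S - M / fact d * norm ?w ^ d * (v \<bullet> sgn ?w)"
    unfolding power2_norm_eq_inner by (subst (1) v_def) (simp add: inner_diff_left)
  also have "\<dots> \<le> L * norm ?w ^ d * norm v / fact d + M / fact d * norm ?w ^ d * norm v"
  proof -
    have "\<bar>v \<bullet> sgn ?w\<bar> \<le> norm v * norm (sgn ?w)"
      by (rule Cauchy_Schwarz_ineq2)
    also have "\<dots> \<le> norm v"
      by (simp add: norm_sgn)
    finally have "M / fact d * norm ?w ^ d * - (v \<bullet> sgn ?w) \<le> M / fact d * norm ?w ^ d * norm v"
      using assms by (intro mult_left_mono) auto
    then show ?thesis
      using taylor_derivative_remainder[of v x ?w] by simp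
  qed
  also have "\<dots> = ((L + M) / fact d * norm ?w ^ d) * norm v"
    by (simp add: field_simps)
  finally have le: "norm v * norm v \<le> ((L + M) / fact d * norm ?w ^ d) * norm v"
    by (simp only: power2_eq_square)
  show ?thesis
  proof (cases "v = 0")
    case True
    then show ?thesis
      using assms lipschitz_constant_nonneg unfolding v_def[symmetric] by simp
  next
    case False
    then show ?thesis
      unfolding v_def[symmetric] by (intro mult_right_le_imp_le[OF le]) simp
  qed
qed

end

subsection \<open>Growth of the accumulated step sizes\<close>

text \<open>After normalizing both sums to 1, Young's inequality is applied termwise.\<close>

lemma Holder_inequality_sum:
  fixes a b :: "'i \<Rightarrow> real"
  assumes "finite I" and pos: "\<And>i. i \<in> I \<Longrightarrow> a i > 0" "\<And>i. i \<in> I \<Longrightarrow> b i > 0"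
    and \<theta>: "0 \<le> \<theta>" "\<theta> \<le> 1"
  shows "(\<Sum>i\<in>I. a i powr \<theta> * b i powr (1 - \<theta>)) \<le> (\<Sum>i\<in>I. a i) powr \<theta> * (\<Sum>i\<in>I. b i) powr (1 - \<theta>)"
proof (cases "I = {}")
  case False
  define SA where "SA = (\<Sum>i\<in>I. a i)"
  define SB where "SB = (\<Sum>i\<in>I. b i)"
  have S: "SA > 0" "SB > 0"
    using False assms unfolding SA_def SB_def by (auto intro!: sum_pos)
  have "(\<Sum>i\<in>I. a i powr \<theta> * b i powr (1 - \<theta>))
      = (\<Sum>i\<in>I. (a i / SA) powr \<theta> * (b i / SB) powr (1 - \<theta>)) * (SA powr \<theta> * SB powr (1 - \<theta>))"
    unfolding sum_distrib_right using S pos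
    by (intro sum.cong refl) (simp add: powr_divide less_imp_le)
  also have "\<dots> \<le> (\<Sum>i\<in>I. \<theta> * (a i / SA) + (1 - \<theta>) * (b i / SB)) * (SA powr \<theta> * SB powr (1 - \<theta>))"
    using S pos \<theta> by (intro mult_right_mono sum_mono Youngs_inequality_0) auto
  also have "(\<Sum>i\<in>I. \<theta> * (a i / SA) + (1 - \<theta>) * (b i / SB)) = \<theta> * (SA / SA) + (1 - \<theta>) * (SB / SB)"
    by (simp add: sum.distrib SA_def SB_def flip: sum_distrib_left sum_divide_distrib)
  also have "\<dots> = 1"
    using S by simp
  finally show ?thesis
    by (simp add: SA_def SB_def)
qed simp

text \<open>The right-hand side is the tangent at \<open>a\<close> of the concave power with
  exponent \<open>1 - q\<close>; factoring out \<open>a powr (- q)\<close> leaves Young's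
  inequality.\<close>

lemma powr_below_tangent:
  fixes a b q :: real
  assumes "a > 0" "b \<ge> 0" "0 \<le> q" "q < 1"
  shows "b powr (1 - q) \<le> a powr (1 - q) - (1 - q) * a powr (- q) * (a - b)"
proof -
  have eq: "a powr (1 - q) - (1 - q) * a powr (- q) * (a - b) = a powr (- q) * (q * a + (1 - q) * b)"
  proof -
    have "a powr (1 - q) = a powr (- q) * a"
      using \<open>a > 0\<close> powr_add[of a "- q" 1] by simp
    then show ?thesis by (simp add: algebra_simps)
  qed
  show ?thesis
  proof (cases "b = 0")
    case True
    then show ?thesis
      unfolding eq using assms by simp
  next
    case False
    then have "a powr (- q) * (a powr q * b powr (1 - q)) \<le> a powr (- q) * (q * a + (1 - q) * b)"
      using assms by (intro mult_left_mono Youngs_inequality_0) auto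
    moreover have "a powr (- q) * (a powr q * b powr (1 - q)) = b powr (1 - q)"
      using \<open>a > 0\<close> by (simp flip: mult.assoc powr_add)
    ultimately show ?thesis
      unfolding eq by simp
  qed
qed

text \<open>
  Discrete Gronwall argument: with \<open>S m\<close> the sum on the left-hand side of the hypothesis, the
  hypothesis bounds the increment of \<open>S\<close> from below by a multiple of \<open>S m powr q\<close>, hence
  \<open>S m powr (1 - q)\<close> grows at least linearly.
\<close>

lemma powr_sum_growth:
  fixes A :: "nat \<Rightarrow> real" and p C :: real
  assumes p: "p \<ge> 1" and C: "C > 0" and k: "k \<ge> 1"
    and pos: "\<And>j. j \<in> {1..k} \<Longrightarrow> A j > 0"
    and hyp: "\<And>m. m \<in> {1..k} \<Longrightarrow>
      C * (\<Sum>j=1..m. A j powr ((p - 1) / (3 * p + 1))) \<le> A m powr ((p + 1) / (3 * p + 1))"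
  shows "(2 * C * real k / (p + 1)) powr ((3 * p + 1) / 2) \<le> A k"
proof -
  define \<theta> where "\<theta> = (p - 1) / (3 * p + 1)"
  \<comment> \<open>The exponent is \<open>\<theta> * ((3 * p + 1) / (p + 1))\<close>, which is what
    \<open>A_ge\<close> produces when raised to the power \<open>\<theta>\<close>.\<close>
  define q where "q = (p - 1) / (p + 1)"
  define S where "S m = (\<Sum>j=1..m. A j powr \<theta>)" for m
  have q: "0 \<le> q" "q < 1" "1 - q = 2 / (p + 1)"
    using p by (auto simp: q_def field_simps)
  have S_pos: "S m > 0" if "m \<in> {1..k}" for m
    unfolding S_def using that pos by (intro sum_pos) (auto simp: less_imp_neq[symmetric])
  have A_ge: "(C * S m) powr ((3 * p + 1) / (p + 1)) \<le> A m" if m: "m \<in> {1..k}" for m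
  proof -
    have "(C * S m) powr ((3 * p + 1) / (p + 1)) \<le> (A m powr ((p + 1) / (3 * p + 1))) powr ((3 * p + 1) / (p + 1))"
      using hyp[OF m] S_pos[OF m] C p unfolding S_def \<theta>_def by (intro powr_mono2) auto
    also have "\<dots> = A m"
      using p pos[OF m] by (simp add: powr_powr)
    finally show ?thesis .
  qed
  \<comment> \<open>The tangent is taken at the right endpoint \<open>S (Suc m)\<close>, because the
    increment is bounded below in terms of that value. The case \<open>m = 0\<close>, with
    \<open>S 0 = 0\<close>, is included.\<close>
  have step: "S m powr (1 - q) + (1 - q) * C powr q \<le> S (Suc m) powr (1 - q)" if m: "Suc m \<in> {1..k}" for m
  proof -
    have "(C * S (Suc m)) powr q = ((C * S (Suc m)) powr ((3 * p + 1) / (p + 1))) powr \<theta>"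
      using p by (simp add: powr_powr q_def \<theta>_def)
    also have "\<dots> \<le> A (Suc m) powr \<theta>"
      using A_ge[OF m] p by (intro powr_mono2) (auto simp: \<theta>_def)
    also have "\<dots> = S (Suc m) - S m"
      by (simp add: S_def)
    finally have "C powr q * S (Suc m) powr q \<le> S (Suc m) - S m"
      using C S_pos[OF m] by (simp add: powr_mult)
    then have "(1 - q) * S (Suc m) powr (- q) * (C powr q * S (Suc m) powr q)
        \<le> (1 - q) * S (Suc m) powr (- q) * (S (Suc m) - S m)"
      using q(1,2) by (intro mult_left_mono) auto
    moreover have "(1 - q) * S (Suc m) powr (- q) * (C powr q * S (Suc m) powr q) = (1 - q) * C powr q"
      using S_pos[OF m] by (simp add: powr_minus)
    moreover have "S m powr (1 - q) \<le> S (Suc m) powr (1 - q) - (1 - q) * S (Suc m) powr (- q) * (S (Suc m) - S m)"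
      using S_pos[OF m] q by (intro powr_below_tangent) (auto simp: S_def intro: sum_nonneg)
    ultimately show ?thesis by linarith
  qed
  have "real m * ((1 - q) * C powr q) \<le> S m powr (1 - q)" if "m \<le> k" for m
    using that
  proof (induction m)
    case (Suc m)
    then show ?case
      using step[of m] by (simp add: algebra_simps)
  qed simp
  from this[of k] have "(real k * ((1 - q) * C powr q)) powr ((p + 1) / 2) \<le> (S k powr (1 - q)) powr ((p + 1) / 2)"
    using p q k by (intro powr_mono2) auto
  also have "\<dots> = S k"
  proof -
    have "(1 - q) * ((p + 1) / 2) = 1"
      unfolding q(3) using p by simp
    then show ?thesis
      unfolding powr_powr using S_pos[of k] k by (simp only:) simp
  qed
  finally have "(2 * real k / (p + 1) * C powr q) powr ((p + 1) / 2) \<le> S k"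
    by (simp add: q(3) mult_ac)
  then have "C * (2 * real k / (p + 1) * C powr q) powr ((p + 1) / 2) \<le> C * S k"
    using C by simp
  moreover have "C * (2 * real k / (p + 1) * C powr q) powr ((p + 1) / 2) = (2 * C * real k / (p + 1)) powr ((p + 1) / 2)"
  proof -
    have "(C powr q) powr ((p + 1) / 2) = C powr ((p - 1) / 2)"
      using p by (simp add: powr_powr q_def)
    moreover have "C * C powr ((p - 1) / 2) = C powr ((p + 1) / 2)"
      using C by (simp add: powr_mult_base field_simps)
    moreover have "(2 * C * real k / (p + 1)) = (2 * real k / (p + 1)) * C"
      by simp
    ultimately show ?thesis
      using C p by (simp only: powr_mult) (simp add: mult.left_commute)
  qed
  ultimately have "(2 * C * real k / (p + 1)) powr ((p + 1) / 2) \<le> C * S k"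
    by (simp only:)
  then have "((2 * C * real k / (p + 1)) powr ((p + 1) / 2)) powr ((3 * p + 1) / (p + 1))
      \<le> (C * S k) powr ((3 * p + 1) / (p + 1))"
    using p C by (intro powr_mono2) auto
  also have "\<dots> \<le> A k"
    using A_ge k by simp
  finally have "((2 * C * real k / (p + 1)) powr ((p + 1) / 2)) powr ((3 * p + 1) / (p + 1)) \<le> A k" .
  moreover have "(p + 1) / 2 * ((3 * p + 1) / (p + 1)) = (3 * p + 1) / 2"
    using p by (simp add: field_simps)
  ultimately show ?thesis
    by (simp only: powr_powr)
qed

lemma sqrt_powr_double:
  assumes "x \<ge> 0"
  shows "sqrt x powr (2 * q) = x powr q"
  using assms by (simp add: powr_powr flip: powr_half_sqrt)

text \<open>Only real sequences enter: \<open>w j\<close> stands for the length of step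
  \<open>j\<close>, \<open>c\<close> for the lower large-step threshold and \<open>B\<close> for the
  bound on the weighted sum of squared lengths.\<close>

lemma accumulated_step_growth:
  fixes A lam w :: "nat \<Rightarrow> real" and B c :: real
  assumes d: "d \<ge> 1" and k: "k \<ge> 1" and c: "c > 0" and A0: "A 0 = 0"
    and lam: "\<And>j. j \<in> {1..k} \<Longrightarrow> lam j > 0"
    and sqrt_step: "\<And>j. j < k \<Longrightarrow> sqrt (A j) + sqrt (lam (Suc j)) / 2 \<le> sqrt (A (Suc j))"
    and w: "\<And>j. w j \<ge> 0"
    and large: "\<And>j. j \<in> {1..k} \<Longrightarrow> c \<le> lam j * w j ^ (d - 1)"
    and bound: "(\<Sum>j=1..k. A j / lam j * (w j)\<^sup>2) \<le> B"
  shows "(2 * real k / (real d + 1)) powr ((3 * real d + 1) / 2) * (c * B powr (- (real d - 1) / 2)) / 2 ^ (d + 1) \<le> A k"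
proof -
  have sqrt_sum: "(\<Sum>j=1..m. sqrt (lam j)) \<le> 2 * sqrt (A m)" if "m \<le> k" for m
    using that
  proof (induction m)
    case (Suc m)
    then show ?case
      using sqrt_step[of m] by simp
  qed (simp add: A0)
  have A_pos: "A m > 0" if m: "m \<in> {1..k}" for m
  proof -
    have "0 < (\<Sum>j=1..m. sqrt (lam j))"
      using m lam by (intro sum_pos) auto
    also have "\<dots> \<le> 2 * sqrt (A m)"
      using m by (intro sqrt_sum) simp
    finally show ?thesis
      by simp
  qed
  show ?thesis
  \<comment> \<open>For \<open>d = 1\<close> the large-step condition bounds \<open>lam j\<close>
    itself and permits \<open>w j = 0\<close>, so the sum of square roots is used directly.
    Otherwise it forces \<open>w j > 0\<close>.\<close>
  proof (cases "d = 1")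
    case True
    have "real k * sqrt c = (\<Sum>j=1..k. sqrt c)"
      by simp
    also have "\<dots> \<le> (\<Sum>j=1..k. sqrt (lam j))"
      using large True by (intro sum_mono) auto
    also have "\<dots> \<le> 2 * sqrt (A k)"
      by (rule sqrt_sum) simp
    finally have "(real k * sqrt c)\<^sup>2 \<le> (2 * sqrt (A k))\<^sup>2"
      using c by (intro power_mono) auto
    then have "(real k)\<^sup>2 * c \<le> 4 * A k"
      using c A_pos[of k] k by (simp add: power_mult_distrib)
    \<comment> \<open>only an inequality, as \<open>0 powr 0 = 0\<close>\<close>
    moreover have "(real k)\<^sup>2 * (c * B powr 0) \<le> (real k)\<^sup>2 * c"
      using c by (intro mult_left_mono) auto
    ultimately show ?thesis
      using True k A_pos[of k] by (simp add: powr_numeral)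
  next
    case False
    define p where "p = real d"
    have p: "p > 1"
      using d False by (simp add: p_def)
    define \<theta> where "\<theta> = (p - 1) / (3 * p + 1)"
    have \<theta>: "0 \<le> \<theta>" "\<theta> \<le> 1" "1 - \<theta> = 2 * ((p + 1) / (3 * p + 1))"
      using p by (auto simp: \<theta>_def field_simps)
    have w_pos: "w j > 0" if j: "j \<in> {1..k}" for j
    proof (rule ccontr)
      assume "\<not> w j > 0"
      then have "w j = 0"
        using w[of j] by simp
      then show False
        using large[OF j] c d False by (simp add: power_0_left)
    qed
    define b where "b j = A j / lam j * (w j)\<^sup>2" for j
    have b: "b j > 0" if "j \<in> {1..k}" for j
      using A_pos[OF that] lam[OF that] w_pos[OF that] by (simp add: b_def)
    have B_ge: "(\<Sum>j=1..m. b j) \<le> B" if "m \<le> k" for m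
    proof -
      have "(\<Sum>j=1..m. b j) \<le> (\<Sum>j=1..k. b j)"
        using that b by (intro sum_mono2) (auto simp: less_imp_le)
      then show ?thesis
        using bound by (simp add: b_def)
    qed
    have B: "B > 0"
      using B_ge[of 1] b[of 1] k by simp
    \<comment> \<open>eliminates \<open>w j\<close> between the large-step condition and the definition of \<open>b j\<close>\<close>
    have A_le: "A j powr \<theta> \<le> c powr (- 2 / (3 * p + 1)) * (b j powr \<theta> * sqrt (lam j) powr (1 - \<theta>))"
      if j: "j \<in> {1..k}" for j
    proof -
      note pos = A_pos[OF j] lam[OF j] w_pos[OF j] b[OF j] c
      have "c\<^sup>2 \<le> (lam j * w j ^ (d - 1))\<^sup>2"
        using large[OF j] c by (intro power_mono) auto
      also have "\<dots> = (lam j)\<^sup>2 * ((w j)\<^sup>2) ^ (d - 1)"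
        by (simp add: power_mult_distrib flip: power_mult) (simp add: mult.commute)
      finally have "c\<^sup>2 * A j ^ (d - 1) \<le> (lam j)\<^sup>2 * ((w j)\<^sup>2) ^ (d - 1) * A j ^ (d - 1)"
        using pos by (intro mult_right_mono) auto
      also have "\<dots> = b j ^ (d - 1) * lam j ^ (d + 1)"
      proof -
        have "A j * (w j)\<^sup>2 = b j * lam j"
          using pos by (simp add: b_def)
        then have "((w j)\<^sup>2) ^ (d - 1) * A j ^ (d - 1) = b j ^ (d - 1) * lam j ^ (d - 1)"
          by (metis mult.commute power_mult_distrib)
        moreover have "lam j ^ (d + 1) = (lam j)\<^sup>2 * lam j ^ (d - 1)"
          using d by (simp flip: power_add)
        ultimately show ?thesis by simp
      qed
      finally have "c\<^sup>2 * A j ^ (d - 1) \<le> b j ^ (d - 1) * lam j ^ (d + 1)" .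
      moreover have "p - 1 = real (d - 1)" "p + 1 = real (d + 1)"
        using d by (simp_all add: p_def)
      ultimately have "c powr 2 * A j powr (p - 1) \<le> b j powr (p - 1) * lam j powr (p + 1)"
        using pos by (simp only: powr_realpow powr_numeral)
      then have "(c powr 2 * A j powr (p - 1)) powr (1 / (3 * p + 1))
          \<le> (b j powr (p - 1) * lam j powr (p + 1)) powr (1 / (3 * p + 1))"
        using p by (intro powr_mono2) auto
      then have le: "c powr (2 / (3 * p + 1)) * A j powr \<theta> \<le> b j powr \<theta> * lam j powr ((p + 1) / (3 * p + 1))"
        by (simp only: powr_mult powr_powr \<theta>_def times_divide_eq_right mult_1_right)
      have "lam j powr ((p + 1) / (3 * p + 1)) = sqrt (lam j) powr (1 - \<theta>)"
        unfolding \<theta>(3) using pos by (simp only: sqrt_powr_double less_imp_le)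
      then have "c powr (- 2 / (3 * p + 1)) * (c powr (2 / (3 * p + 1)) * A j powr \<theta>)
          \<le> c powr (- 2 / (3 * p + 1)) * (b j powr \<theta> * sqrt (lam j) powr (1 - \<theta>))"
        using le by (intro mult_left_mono) auto
      then show ?thesis
        using c by (simp flip: mult.assoc powr_add)
    qed
    \<comment> \<open>This is the reciprocal of the product of the constants from
      \<open>A_le\<close>, the bound \<open>B\<close> and the factor 2 in \<open>sqrt_sum\<close>,
      as they leave Hoelder's inequality.\<close>
    define C where "C = c powr (2 / (3 * p + 1)) * B powr (- \<theta>) * 2 powr (- (1 - \<theta>))"
    have C: "C > 0"
      using c B by (simp add: C_def)
    have hyp: "C * (\<Sum>j=1..m. A j powr ((p - 1) / (3 * p + 1))) \<le> A m powr ((p + 1) / (3 * p + 1))"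
      if m: "m \<in> {1..k}" for m
    proof -
      let ?c = "c powr (- 2 / (3 * p + 1))"
      have "(\<Sum>j=1..m. A j powr \<theta>) \<le> (\<Sum>j=1..m. ?c * (b j powr \<theta> * sqrt (lam j) powr (1 - \<theta>)))"
        using m by (intro sum_mono A_le) auto
      also have "\<dots> = ?c * (\<Sum>j=1..m. b j powr \<theta> * sqrt (lam j) powr (1 - \<theta>))"
        by (simp add: sum_distrib_left)
      also have "\<dots> \<le> ?c * ((\<Sum>j=1..m. b j) powr \<theta> * (\<Sum>j=1..m. sqrt (lam j)) powr (1 - \<theta>))"
        using m b lam \<theta> by (intro mult_left_mono Holder_inequality_sum) auto
      also have "\<dots> \<le> ?c * (B powr \<theta> * (2 * sqrt (A m)) powr (1 - \<theta>))"
        using m \<theta> b lam B_ge[of m] sqrt_sum[of m]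
        by (intro mult_left_mono mult_mono powr_mono2) (auto intro!: sum_nonneg simp: less_imp_le)
      finally have "C * (\<Sum>j=1..m. A j powr \<theta>) \<le> C * (?c * (B powr \<theta> * (2 * sqrt (A m)) powr (1 - \<theta>)))"
        using C by (intro mult_left_mono) auto
      also have "\<dots> = sqrt (A m) powr (1 - \<theta>)"
      proof -
        have "c powr (2 / (3 * p + 1)) * ?c = 1" "B powr (- \<theta>) * B powr \<theta> = 1"
          "2 powr (- (1 - \<theta>)) * 2 powr (1 - \<theta>) = (1::real)"
          using c B by (simp_all flip: powr_add)
        moreover have "C * (?c * (B powr \<theta> * (2 * sqrt (A m)) powr (1 - \<theta>)))
            = (c powr (2 / (3 * p + 1)) * ?c) * (B powr (- \<theta>) * B powr \<theta>)
              * (2 powr (- (1 - \<theta>)) * 2 powr (1 - \<theta>)) * sqrt (A m) powr (1 - \<theta>)"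
          using A_pos[OF m] by (simp only: C_def powr_mult mult_ac)
        ultimately show ?thesis by simp
      qed
      also have "\<dots> = A m powr ((p + 1) / (3 * p + 1))"
        unfolding \<theta>(3) using A_pos[OF m] by (simp only: sqrt_powr_double less_imp_le)
      finally show ?thesis
        by (simp only: \<theta>_def)
    qed
    have "(2 * C * real k / (p + 1)) powr ((3 * p + 1) / 2) \<le> A k"
      using p C k A_pos hyp by (intro powr_sum_growth) auto
    moreover have "(2 * C * real k / (p + 1)) powr ((3 * p + 1) / 2)
        = (2 * real k / (p + 1)) powr ((3 * p + 1) / 2) * C powr ((3 * p + 1) / 2)"
    proof -
      have "2 * C * real k / (p + 1) = 2 * real k / (p + 1) * C"
        by simp
      then show ?thesis
        by (simp only: powr_mult)
    qed
    moreover have "C powr ((3 * p + 1) / 2) = c * B powr (- (p - 1) / 2) / 2 ^ (d + 1)"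
    proof -
      have c_exp: "2 / (3 * p + 1) * ((3 * p + 1) / 2) = 1"
        using p by simp
      have B_exp: "- \<theta> * ((3 * p + 1) / 2) = - (p - 1) / 2"
        using p by (simp add: \<theta>_def)
      have two_exp: "- (1 - \<theta>) * ((3 * p + 1) / 2) = - (p + 1)"
        unfolding \<theta>(3) using p by (simp add: field_simps)
      have "2 powr (p + 1) = 2 powr real (d + 1)"
        by (simp add: p_def add.commute)
      also have "\<dots> = 2 ^ (d + 1)"
        by (rule powr_realpow) simp
      finally have two: "2 powr (- (p + 1)) = inverse (2 ^ (d + 1) :: real)"
        by (simp only: powr_minus)
      show ?thesis
        unfolding C_def powr_mult powr_powr c_exp B_exp two_exp two
        using c by (simp only: powr_one less_imp_le divide_inverse[of _ "2 ^ (d + 1)"])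
    qed
    ultimately show ?thesis
      by (simp add: p_def)
  qed
qed

text \<open>The lower bound on \<open>A\<close> is inserted into
  \<open>\<delta> \<le> D\<^sup>2 / (2 * A)\<close>, and \<open>D ^ (d - 1)\<close> from the growth
  bound joins \<open>D\<^sup>2\<close>. For \<open>D = 0\<close> the growth bound is trivial, but
  the potential already gives \<open>\<delta> \<le> 0\<close>.\<close>

lemma complexity_bound_from_growth:
  fixes D S c \<delta> A :: real
  assumes d: "d \<ge> 1" and k: "k \<ge> 1" and S: "S > 0" and c: "c > 0" and D: "D \<ge> 0" and A: "A > 0"
    and growth: "(2 * real k / (real d + 1)) powr ((3 * real d + 1) / 2)
        * (c * (D\<^sup>2 / S) powr (- (real d - 1) / 2)) / 2 ^ (d + 1) \<le> A"
    and potential: "2 * (A * \<delta>) \<le> D\<^sup>2"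
  shows "\<delta> \<le> ((real d + 1) / 2) powr ((3 * real d + 1) / 2) * (2 ^ d / (S powr ((real d - 1) / 2) * c))
      * D ^ (d + 1) * real k powr (- ((3 * real d + 1) / 2))"
proof (cases "D = 0")
  case True
  then have "\<delta> \<le> 0"
    using potential A by (simp add: mult_le_0_iff)
  then show ?thesis
    using True by simp
next
  case False
  then have D: "D > 0"
    using D by simp
  define \<alpha> where "\<alpha> = (3 * real d + 1) / 2"
  define \<beta> where "\<beta> = (real d - 1) / 2"
  define G where "G = (2 * real k / (real d + 1)) powr \<alpha> * (c * (D\<^sup>2 / S) powr (- \<beta>)) / 2 ^ (d + 1)"
  have G: "G > 0"
    using k c D S unfolding G_def by (intro divide_pos_pos mult_pos_pos) auto
  have "G \<le> A"
    using growth by (simp add: G_def \<alpha>_def \<beta>_def minus_divide_left)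
  have "\<delta> \<le> D\<^sup>2 / (2 * A)"
    using potential A by (simp add: field_simps)
  also have "\<dots> \<le> D\<^sup>2 / (2 * G)"
    using \<open>G \<le> A\<close> G by (intro divide_left_mono) auto
  also have "\<dots> = ((real d + 1) / 2) powr \<alpha> * (2 ^ d / (S powr \<beta> * c)) * D ^ (d + 1) * real k powr (- \<alpha>)"
  proof -
    define K E Q R where "K = real k powr \<alpha>" and "E = ((real d + 1) / 2) powr \<alpha>"
      and "Q = D ^ (d - 1)" and "R = S powr \<beta>"
    have pos: "K > 0" "E > 0" "Q > 0" "R > 0"
      using k D S by (auto simp: K_def E_def Q_def R_def)
    have "D\<^sup>2 powr \<beta> = D powr (2 * \<beta>)"
      using powr_powr[of D 2 \<beta>] D by simp
    also have "2 * \<beta> = real (d - 1)"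
      using d by (simp add: \<beta>_def)
    also have "D powr real (d - 1) = Q"
      using D by (simp add: powr_realpow Q_def)
    finally have "(D\<^sup>2 / S) powr (- \<beta>) = R / Q"
      by (simp add: powr_minus powr_divide R_def)
    moreover have "(2 * real k / (real d + 1)) powr \<alpha> = K / E"
    proof -
      have "2 * real k / (real d + 1) = real k / ((real d + 1) / 2)"
        by simp
      then show ?thesis
        by (simp only: powr_divide K_def E_def)
    qed
    ultimately have G_eq: "G = K / E * (c * (R / Q)) / (2 * 2 ^ d)"
      by (simp add: G_def)
    have "D\<^sup>2 / (2 * G) = E * (2 ^ d / (R * c)) * (D\<^sup>2 * Q) * inverse K"
      unfolding G_eq using pos c by (simp add: field_simps)
    moreover have "D\<^sup>2 * Q = D ^ (d + 1)"
      using d unfolding Q_def by (simp flip: power_add)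
    ultimately show ?thesis
      by (simp only: K_def E_def R_def powr_minus)
  qed
  finally show ?thesis
    by (simp add: \<alpha>_def \<beta>_def)
qed

subsection \<open>Inexact accelerated proximal steps\<close>

text \<open>Carries estimates valid for every minimizer over to the distance from the set of
  minimizers.\<close>

lemma le_infdist_power2:
  fixes X :: "'a::metric_space set"
  assumes "X \<noteq> {}" "\<And>z. z \<in> X \<Longrightarrow> r \<le> (dist a z)\<^sup>2"
  shows "r \<le> (infdist a X)\<^sup>2"
proof (cases "r \<ge> 0")
  case True
  have "sqrt r \<le> dist a z" if "z \<in> X" for z
    using assms(2)[OF that] by (simp add: real_le_lsqrt)
  then have "sqrt r \<le> infdist a X"
    unfolding infdist_notempty[OF \<open>X \<noteq> {}\<close>] using \<open>X \<noteq> {}\<close> by (intro cINF_greatest)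
  then have "(sqrt r)\<^sup>2 \<le> (infdist a X)\<^sup>2"
    using True by (intro power_mono) auto
  then show ?thesis
    using True by simp
next
  case False
  then show ?thesis
    by (meson le_cases order_trans zero_le_power2)
qed

text \<open>The gradient of the convex \<open>f\<close> is an exact subgradient, so the sum inherits
  the error \<open>e\<close> of \<open>h\<close> alone.\<close>

lemma eps_subdifferential_objective:
  fixes f :: "'a::euclidean_space \<Rightarrow> real"
  assumes "convex_on UNIV f" "f differentiable (at y)" "u \<in> eps_subdifferential h e y"
  shows "grad f y + u \<in> eps_subdifferential (objective f h) e y"
proof -
  have f': "(f has_derivative frechet_derivative f (at y)) (at y)"
    using assms(2) by (simp add: frechet_derivative_works)
  have "objective f h z \<ge> objective f h y + ereal ((z - y) \<bullet> (grad f y + u)) - ereal e" for z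
  proof -
    have "f y + (z - y) \<bullet> grad f y \<le> f z"
      using convex_on_imp_above_tangent_hyperplane[OF assms(1) f', of z] grad_inner[OF f', of "z - y"]
      by (simp add: inner_commute)
    moreover have "h z \<ge> h y + ereal ((z - y) \<bullet> u) - ereal e"
      using assms(3) unfolding eps_subdifferential_def by blast
    ultimately show ?thesis
      unfolding objective_def by (cases "h z"; cases "h y") (auto simp: inner_add_right)
  qed
  then show ?thesis
    unfolding eps_subdifferential_def by blast
qed

text \<open>An infinite \<open>F y\<close> would contradict the subgradient inequality at a point
  where \<open>F\<close> is finite. This allows the potential argument to run in the reals.\<close>

lemma eps_subdifferential_real:
  assumes u: "u \<in> eps_subdifferential F e y"
    and F: "\<And>z. F z \<noteq> - \<infinity>" and z: "F z \<noteq> \<infinity>"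
  shows "\<bar>F y\<bar> \<noteq> \<infinity>"
    and "real_of_ereal (F y) + u \<bullet> (z - y) - e \<le> real_of_ereal (F z)"
proof -
  have le: "F y + ereal ((z - y) \<bullet> u) - ereal e \<le> F z"
    using u unfolding eps_subdifferential_def by blast
  show "\<bar>F y\<bar> \<noteq> \<infinity>"
    using le z F[of y] by auto
  then show "real_of_ereal (F y) + u \<bullet> (z - y) - e \<le> real_of_ereal (F z)"
    using le z F[of z] by (cases "F y"; cases "F z") (auto simp: inner_commute)
qed

text \<open>Replacing \<open>u\<close> by \<open>v\<close> shifts the residual by \<open>lam\<close>
  times the gradient error of the model, which the upper large-step bound limits to
  \<open>\<sigma>\<^sub>u * norm (y - x)\<close>.\<close>

lemma (in lipschitz_derivative) approx_solution_residual:
  assumes sol: "approx_solution f h d M \<sigma> lam x (y, u, e)"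
    and M: "M > 0" and lam: "lam > 0" and \<sigma>: "\<sigma> \<ge> 0"
    and step: "lam * norm (y - x) ^ (d - 1) \<le> fact d * \<sigma>\<^sub>u / (L + M)"
    and v: "v = grad f y + u - grad (taylor_model f d M x) y"
  shows "(norm (lam *\<^sub>R v + y - x))\<^sup>2 + 2 * lam * e \<le> (\<sigma> + \<sigma>\<^sub>u)\<^sup>2 * (norm (y - x))\<^sup>2"
proof -
  define w where "w = norm (y - x)"
  define r where "r = norm (lam *\<^sub>R u + y - x)"
  have w: "w \<ge> 0"
    by (simp add: w_def)
  have LM: "L + M > 0"
    using lipschitz_constant_nonneg M by simp
  have e: "e \<ge> 0" and r: "r\<^sup>2 + 2 * lam * e \<le> \<sigma>\<^sup>2 * w\<^sup>2"
    using sol by (auto simp: approx_solution_def w_def r_def)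
  have "norm (lam *\<^sub>R (grad f y - grad (taylor_model f d M x) y)) \<le> lam * ((L + M) / fact d * w ^ d)"
    using mult_left_mono[OF grad_taylor_model_error[of M y x], of lam] M lam
    unfolding w_def by (simp only: norm_scaleR abs_of_pos less_imp_le)
  also have "\<dots> = (lam * w ^ (d - 1)) * ((L + M) / fact d * w)"
    using d by (simp add: power_eq_if[of w d])
  also have "\<dots> \<le> (fact d * \<sigma>\<^sub>u / (L + M)) * ((L + M) / fact d * w)"
    using step LM w unfolding w_def[symmetric] by (intro mult_right_mono) auto
  also have "\<dots> = \<sigma>\<^sub>u * w"
    using LM by simp
  finally have err: "norm (lam *\<^sub>R (grad f y - grad (taylor_model f d M x) y)) \<le> \<sigma>\<^sub>u * w" .
  have "lam *\<^sub>R v + y - x = (lam *\<^sub>R u + y - x) + lam *\<^sub>R (grad f y - grad (taylor_model f d M x) y)"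
    by (simp add: v algebra_simps)
  then have "norm (lam *\<^sub>R v + y - x) \<le> r + \<sigma>\<^sub>u * w"
    using norm_triangle_ineq[of "lam *\<^sub>R u + y - x"] err unfolding r_def by (smt (verit))
  then have "(norm (lam *\<^sub>R v + y - x))\<^sup>2 \<le> (r + \<sigma>\<^sub>u * w)\<^sup>2"
    by (intro power_mono) auto
  \<comment> \<open>The error \<open>e\<close> is dropped only here, for the cross term; in the
    final sum it stays paired with \<open>r\<^sup>2\<close>.\<close>
  moreover have "r \<le> \<sigma> * w"
  proof (rule power2_le_imp_le)
    show "r\<^sup>2 \<le> (\<sigma> * w)\<^sup>2"
      using r e lam by (simp add: power_mult_distrib) (smt (verit) mult_nonneg_nonneg)
  qed (use \<sigma> w in simp)
  moreover have "\<sigma>\<^sub>u * w \<ge> 0"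
    using err norm_ge_zero order_trans by blast
  ultimately have "(norm (lam *\<^sub>R v + y - x))\<^sup>2 + 2 * lam * e \<le> \<sigma>\<^sup>2 * w\<^sup>2 + 2 * (\<sigma> * w) * (\<sigma>\<^sub>u * w) + (\<sigma>\<^sub>u * w)\<^sup>2"
    using r mult_right_mono[of r "\<sigma> * w" "\<sigma>\<^sub>u * w"] by (simp add: power2_sum)
  also have "\<dots> = (\<sigma> + \<sigma>\<^sub>u)\<^sup>2 * w\<^sup>2"
    by (simp add: power2_eq_square algebra_simps)
  finally show ?thesis
    by (simp add: w_def)
qed

text \<open>Adds the subgradient inequality at \<open>y\<close> with weight \<open>A\<close> to the
  one at \<open>z\<close> with weight \<open>a\<close>. The former is assumed in multiplied form so
  that it also covers \<open>A = 0\<close>, where \<open>y\<close> may lie outside the domain of the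
  objective.\<close>

lemma accelerated_proximal_step:
  fixes x y xt y' v z :: "'a::real_inner"
  assumes lam: "lam > 0" and A: "A \<ge> 0" "a > 0" and a: "a\<^sup>2 = lam * (A + a)"
    and xt: "(A + a) *\<^sub>R xt = A *\<^sub>R y + a *\<^sub>R x"
    and z: "Fy' + v \<bullet> (z - y') - e \<le> Fz"
    and y: "A * (Fy' + v \<bullet> (y - y') - e) \<le> A * Fy"
    and res: "(norm (lam *\<^sub>R v + y' - xt))\<^sup>2 + 2 * lam * e \<le> s\<^sup>2 * (norm (y' - xt))\<^sup>2"
  shows "(A + a) * (Fy' - Fz) + (norm (x - a *\<^sub>R v - z))\<^sup>2 / 2
      + (1 - s\<^sup>2) / 2 * ((A + a) / lam * (norm (y' - xt))\<^sup>2)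
    \<le> A * (Fy - Fz) + (norm (x - z))\<^sup>2 / 2"
proof -
  define w where "w = y' - xt"
  define P where "P = A + a"
  have P: "P > 0"
    using A by (simp add: P_def)
  have "a * (Fy' + v \<bullet> (z - y') - e) \<le> a * Fz"
    using z A by (intro mult_left_mono) auto
  with y have "P * Fy' - P * e + (A * (v \<bullet> (y - y')) + a * (v \<bullet> (z - y'))) \<le> A * Fy + a * Fz"
    by (simp add: P_def algebra_simps)
  \<comment> \<open>The choice of \<open>xt\<close> collapses the weighted directions to
    \<open>x - z\<close> and \<open>y' - xt\<close>.\<close>
  moreover have "A * (v \<bullet> (y - y')) + a * (v \<bullet> (z - y')) = - a * (v \<bullet> (x - z)) - P * (v \<bullet> w)"
  proof -
    have "A *\<^sub>R (y - y') + a *\<^sub>R (z - y') = (A *\<^sub>R y + a *\<^sub>R x) - a *\<^sub>R (x - z) - P *\<^sub>R y'"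
      by (simp add: P_def algebra_simps)
    also have "\<dots> = - a *\<^sub>R (x - z) - P *\<^sub>R w"
      unfolding xt[symmetric] w_def P_def by (simp add: algebra_simps)
    finally have "v \<bullet> (A *\<^sub>R (y - y') + a *\<^sub>R (z - y')) = v \<bullet> (- a *\<^sub>R (x - z) - P *\<^sub>R w)"
      by simp
    then show ?thesis
      by (simp only: inner_add_right inner_diff_right[of v "- a *\<^sub>R (x - z)"] inner_scaleR_right)
  qed
  moreover have "(norm (x - a *\<^sub>R v - z))\<^sup>2 = (norm (x - z))\<^sup>2 - 2 * (a * (v \<bullet> (x - z))) + a\<^sup>2 * (norm v)\<^sup>2"
  proof -
    have "x - a *\<^sub>R v - z = (x - z) - a *\<^sub>R v"
      by simp
    then show ?thesis
      unfolding power2_norm_eq_inner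
      by (simp only:) (simp add: inner_diff_left inner_diff_right inner_commute power2_eq_square algebra_simps)
  qed
  \<comment> \<open>The residual bound divided by \<open>2 * lam\<close>. Its term in
    \<open>(norm v)\<^sup>2\<close>, scaled by \<open>P\<close>, cancels the one from the update of
    \<open>x\<close> because \<open>a\<^sup>2 = lam * P\<close>.\<close>
  moreover have le: "P * (lam / 2 * (norm v)\<^sup>2 + v \<bullet> w + e) \<le> P * (- (1 - s\<^sup>2) / 2 * ((norm w)\<^sup>2 / lam))"
  proof (rule mult_left_mono)
    have "lam *\<^sub>R v + y' - xt = lam *\<^sub>R v + w"
      by (simp add: w_def)
    then have "(norm (lam *\<^sub>R v + y' - xt))\<^sup>2 = lam * (lam * (norm v)\<^sup>2) + 2 * (lam * (v \<bullet> w)) + (norm w)\<^sup>2"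
      unfolding power2_norm_eq_inner
      by (simp only:) (simp add: inner_add_left inner_add_right inner_commute algebra_simps)
    with res have "2 * lam * (lam / 2 * (norm v)\<^sup>2 + v \<bullet> w + e) \<le> - (1 - s\<^sup>2) * (norm w)\<^sup>2"
      unfolding w_def[symmetric] by (simp add: algebra_simps)
    then show "lam / 2 * (norm v)\<^sup>2 + v \<bullet> w + e \<le> - (1 - s\<^sup>2) / 2 * ((norm w)\<^sup>2 / lam)"
      using lam by (simp add: field_simps)
  qed (use P in simp)
  moreover have "(lam * P) * (norm v)\<^sup>2 / 2 + P * (v \<bullet> w) + P * e + (1 - s\<^sup>2) / 2 * (P / lam * (norm w)\<^sup>2) \<le> 0"
  proof -
    have "P * (- (1 - s\<^sup>2) / 2 * ((norm w)\<^sup>2 / lam)) = - ((1 - s\<^sup>2) / 2 * (P / lam * (norm w)\<^sup>2))"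
      using lam by (simp add: field_simps)
    moreover have "P * (lam / 2 * (norm v)\<^sup>2 + v \<bullet> w + e) = (lam * P) * (norm v)\<^sup>2 / 2 + P * (v \<bullet> w) + P * e"
      by (simp add: algebra_simps)
    ultimately show ?thesis
      using le by linarith
  qed
  moreover have "P * (Fy' - Fz) = P * Fy' - (A * Fz + a * Fz)"
    by (simp add: P_def algebra_simps)
  moreover have "A * (Fy - Fz) = A * Fy - A * Fz" "- a * (v \<bullet> (x - z)) = - (a * (v \<bullet> (x - z)))"
    "- P * (v \<bullet> w) = - (P * (v \<bullet> w))"
    by (simp_all add: algebra_simps)
  ultimately show ?thesis
    unfolding w_def[symmetric] a P_def[symmetric] by linarith
qed

section \<open>Convergence rate of the optimal tensor method\<close>

theorem theorem3p4:
  fixes f :: "real ^ 'n \<Rightarrow> real" and h :: "real ^ 'n \<Rightarrow> ereal"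
    and d k :: nat
    and L M \<sigma> \<sigma>\<^sub>l \<sigma>\<^sub>u rho_bar eps_bar :: real
    and x y u v xt :: "nat \<Rightarrow> real ^ 'n"
    and eps lam a A :: "nat \<Rightarrow> real"
  assumes d: "d \<ge> 1"
    and f_convex: "convex_on UNIV f"
    and f_diff: "times_differentiable d f"
    and f_lipschitz: "\<And>z w. tensor_norm d (\<lambda>zs. deriv_tensor f zs z - deriv_tensor f zs w)
                        \<le> L * norm (z - w)"
    and h: "proper_closed_convex h"
    and minimizers_nonempty: "minimizers (objective f h) \<noteq> {}"
    and M: "M > 0" "M \<ge> L"
    and tolerances: "0 < eps_bar" "eps_bar < 1" "0 < rho_bar" "rho_bar < 1"
    and sigmas: "\<sigma> \<ge> 0" "0 < \<sigma>\<^sub>l" "\<sigma>\<^sub>l < \<sigma>\<^sub>u" "\<sigma>\<^sub>u < 1" "\<sigma> + \<sigma>\<^sub>u < 1"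
      "\<sigma>\<^sub>l * (1 + \<sigma>) ^ (d - 1) < \<sigma>\<^sub>u * (1 - \<sigma>) ^ (d - 1)"
    and k: "k \<ge> 1"
    and run: "optimal_tensor_method_run f h d L M \<sigma> \<sigma>\<^sub>l \<sigma>\<^sub>u rho_bar eps_bar
                x y u v xt eps lam a A k"
    and last_step: "large_step d L M \<sigma>\<^sub>l \<sigma>\<^sub>u (lam k) (xt (k - 1)) (y k)"
  shows "objective f h (y k) - (INF z. objective f h z)
    \<le> ereal (((real d + 1) / 2) powr ((3 * real d + 1) / 2)
        * (2 ^ d / ((1 - (\<sigma> + \<sigma>\<^sub>u)\<^sup>2) powr ((real d - 1) / 2) * fact d * \<sigma>\<^sub>l))
        * infdist (x 0) (minimizers (objective f h)) ^ (d + 1)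
        * (L + M) * real k powr (- ((3 * real d + 1) / 2)))"
proof -
  interpret lipschitz_derivative f d L
    using d f_diff f_lipschitz by unfold_locales
  define F where "F = objective f h"
  define Fr where "Fr z = real_of_ereal (F z)" for z
  define s where "s = \<sigma> + \<sigma>\<^sub>u"
  define c where "c = fact d * \<sigma>\<^sub>l / (L + M)"
  define w where "w j = norm (y j - xt (j - 1))" for j
  have LM: "L + M > 0"
    using lipschitz_constant_nonneg M by simp
  have c: "c > 0"
    using LM sigmas by (simp add: c_def)
  have s: "1 - s\<^sup>2 > 0"
    using sigmas by (simp add: s_def abs_square_less_1)
  have A0: "A 0 = 0"
    using run unfolding optimal_tensor_method_run_def by blast
  have iter:
      "\<not> (norm (v j) \<le> rho_bar \<and> eps j \<le> eps_bar)"
      "lam (Suc j) > 0"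
      "a (Suc j) = (lam (Suc j) + sqrt ((lam (Suc j))\<^sup>2 + 4 * lam (Suc j) * A j)) / 2"
      "xt j = (A j / (A j + a (Suc j))) *\<^sub>R y j + (a (Suc j) / (A j + a (Suc j))) *\<^sub>R x j"
      "approx_solution f h d M \<sigma> (lam (Suc j)) (xt j) (y (Suc j), u (Suc j), eps (Suc j))"
      "large_step d L M \<sigma>\<^sub>l \<sigma>\<^sub>u (lam (Suc j)) (xt j) (y (Suc j)) \<or>
         norm (grad f (y (Suc j)) + u (Suc j) - grad (taylor_model f d M (xt j)) (y (Suc j)))
           \<le> rho_bar \<and> eps (Suc j) \<le> eps_bar"
      "v (Suc j) = grad f (y (Suc j)) + u (Suc j) - grad (taylor_model f d M (xt j)) (y (Suc j))"
      "A (Suc j) = A j + a (Suc j)"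
      "x (Suc j) = x j - a (Suc j) *\<^sub>R v (Suc j)"
    if "j < k" for j
    using run that unfolding optimal_tensor_method_run_def by blast+
  \<comment> \<open>The second alternative of Step 3 is the stopping test for iterate
    \<open>Suc j\<close>. The test fails before \<open>k\<close>, so the step is large; for the
    final iterate this is \<open>last_step\<close>.\<close>
  have large: "large_step d L M \<sigma>\<^sub>l \<sigma>\<^sub>u (lam (Suc j)) (xt j) (y (Suc j))" if j: "j < k" for j
  proof (cases "Suc j = k")
    case True
    then show ?thesis
      using last_step by auto
  next
    case False
    then show ?thesis
      using iter(6)[OF j] iter(1)[of "Suc j"] j unfolding iter(7)[OF j] by auto
  qed
  have lam_sq: "lam (Suc j) > 0 \<Longrightarrow> 0 \<le> A j \<Longrightarrow>
      0 \<le> (lam (Suc j))\<^sup>2 + 4 * lam (Suc j) * A j" for j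
    by simp
  have a_pos: "a (Suc j) > 0" if "j < k" "A j \<ge> 0" for j
    using iter(2,3)[OF that(1)] lam_sq[of j] that(2)
    by (metis add_pos_nonneg half_gt_zero real_sqrt_ge_zero)
  have A_nonneg: "A j \<ge> 0" if "j \<le> k" for j
    using that
  proof (induction j)
    case (Suc j)
    then show ?case
      using a_pos[of j] iter(8)[of j] by simp
  qed (simp add: A0)
  \<comment> \<open>\<open>a (Suc j)\<close> is the positive root of
    \<open>t\<^sup>2 - lam (Suc j) * t - lam (Suc j) * A j\<close>.\<close>
  have a_sq: "(a (Suc j))\<^sup>2 = lam (Suc j) * (A j + a (Suc j))" if j: "j < k" for j
  proof -
    define r where "r = sqrt ((lam (Suc j))\<^sup>2 + 4 * lam (Suc j) * A j)"
    have "r\<^sup>2 = (lam (Suc j))\<^sup>2 + 4 * lam (Suc j) * A j"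
      unfolding r_def using lam_sq[of j] iter(2)[OF j] A_nonneg[of j] j by simp
    moreover have a: "a (Suc j) = (lam (Suc j) + r) / 2"
      using iter(3)[OF j] by (simp add: r_def)
    ultimately show ?thesis
      unfolding a by (simp add: power2_eq_square field_simps)
  qed
  \<comment> \<open>Dropping \<open>(lam (Suc j))\<^sup>2\<close> under the root gives
    \<open>a (Suc j) \<ge> lam (Suc j) / 2 + sqrt (lam (Suc j) * A j)\<close>, which dominates the
    cross terms of the square.\<close>
  have sqrt_step: "sqrt (A j) + sqrt (lam (Suc j)) / 2 \<le> sqrt (A (Suc j))" if j: "j < k" for j
  proof (rule real_le_rsqrt)
    have pos: "lam (Suc j) > 0" "A j \<ge> 0"
      using iter(2)[OF j] A_nonneg[of j] j by auto
    have "2 * (sqrt (A j) * sqrt (lam (Suc j))) = sqrt (4 * lam (Suc j) * A j)"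
      by (simp add: real_sqrt_mult)
    also have "\<dots> \<le> sqrt ((lam (Suc j))\<^sup>2 + 4 * lam (Suc j) * A j)"
      by simp
    finally show "(sqrt (A j) + sqrt (lam (Suc j)) / 2)\<^sup>2 \<le> A (Suc j)"
      using pos iter(3,8)[OF j] by (simp add: power2_sum power_divide)
  qed
  have F_ninf: "F z \<noteq> - \<infinity>" for z
    using h unfolding F_def objective_def proper_closed_convex_def by (cases "h z") auto
  obtain z0 where z0: "F z0 \<noteq> \<infinity>"
    using h unfolding F_def objective_def proper_closed_convex_def by auto
  have min_le: "F z \<le> F z'" if "z \<in> minimizers F" for z z'
    using that by (simp add: minimizers_def)
  have min_fin: "F z \<noteq> \<infinity>" if "z \<in> minimizers F" for z
    using min_le[OF that, of z0] z0 by auto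
  \<comment> \<open>The gradient of the model contained in \<open>u (Suc j)\<close> cancels in
    \<open>v (Suc j)\<close>, leaving \<open>grad f\<close> plus an approximate subgradient of
    \<open>h\<close>.\<close>
  have subgrad: "v (Suc j) \<in> eps_subdifferential F (eps (Suc j)) (y (Suc j))" if j: "j < k" for j
  proof -
    obtain u' where u': "u (Suc j) = grad (taylor_model f d M (xt j)) (y (Suc j)) + u'"
      "u' \<in> eps_subdifferential h (eps (Suc j)) (y (Suc j))"
      using iter(5)[OF j] unfolding approx_solution_def by auto
    have "f differentiable (at (y (Suc j)))"
      using f_diff d unfolding times_differentiable_def by (metis deriv_tensor.simps(1) length_0_conv less_le_trans zero_less_one)
    then have "grad f (y (Suc j)) + u' \<in> eps_subdifferential F (eps (Suc j)) (y (Suc j))"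
      unfolding F_def by (intro eps_subdifferential_objective f_convex u')
    then show ?thesis
      using iter(7)[OF j] u'(1) by simp
  qed
  have y_fin: "\<bar>F (y (Suc j))\<bar> \<noteq> \<infinity>" if "j < k" for j
    using eps_subdifferential_real(1)[OF subgrad[OF that] F_ninf z0] .
  have potential: "A j * (Fr (y j) - Fr z) + (norm (x j - z))\<^sup>2 / 2
      + (1 - s\<^sup>2) / 2 * (\<Sum>i=1..j. A i / lam i * (w i)\<^sup>2) \<le> (norm (x 0 - z))\<^sup>2 / 2"
    if z: "z \<in> minimizers F" and j: "j \<le> k" for z j
    using j
  proof (induction j)
    case (Suc j)
    then have j: "j < k" and A: "A j \<ge> 0"
      using A_nonneg by auto
    have step: "(A j + a (Suc j)) * (Fr (y (Suc j)) - Fr z) + (norm (x j - a (Suc j) *\<^sub>R v (Suc j) - z))\<^sup>2 / 2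
        + (1 - s\<^sup>2) / 2 * ((A j + a (Suc j)) / lam (Suc j) * (norm (y (Suc j) - xt j))\<^sup>2)
        \<le> A j * (Fr (y j) - Fr z) + (norm (x j - z))\<^sup>2 / 2"
    proof (rule accelerated_proximal_step[OF iter(2)[OF j] A a_pos[OF j A] a_sq[OF j]])
      show "(A j + a (Suc j)) *\<^sub>R xt j = A j *\<^sub>R y j + a (Suc j) *\<^sub>R x j"
        using a_pos[OF j A] A unfolding iter(4)[OF j] by (simp add: scaleR_add_right)
      show "Fr (y (Suc j)) + v (Suc j) \<bullet> (z - y (Suc j)) - eps (Suc j) \<le> Fr z"
        unfolding Fr_def by (rule eps_subdifferential_real(2)[OF subgrad[OF j] F_ninf min_fin[OF z]])
      show "A j * (Fr (y (Suc j)) + v (Suc j) \<bullet> (y j - y (Suc j)) - eps (Suc j)) \<le> A j * Fr (y j)"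
      \<comment> \<open>\<open>F (y 0)\<close> may be infinite, in which case
        \<open>Fr (y 0)\<close> is a default value; the factor \<open>A 0 = 0\<close> removes it.
        Later iterates have finite value by \<open>y_fin\<close>.\<close>
      proof (cases j)
        case (Suc i)
        then have "F (y j) \<noteq> \<infinity>"
          using y_fin[of i] j by auto
        then show ?thesis
          unfolding Fr_def using A
          by (intro mult_left_mono eps_subdifferential_real(2)[OF subgrad[OF j] F_ninf])
      qed (simp add: A0)
      show "(norm (lam (Suc j) *\<^sub>R v (Suc j) + y (Suc j) - xt j))\<^sup>2 + 2 * lam (Suc j) * eps (Suc j)
          \<le> s\<^sup>2 * (norm (y (Suc j) - xt j))\<^sup>2"
        unfolding s_def
        using approx_solution_residual[OF iter(5)[OF j] M(1) iter(2)[OF j] sigmas(1) _ iter(7)[OF j]]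
          large[OF j] unfolding large_step_def by blast
    qed
    have "(1 - s\<^sup>2) / 2 * (\<Sum>i=1..Suc j. A i / lam i * (w i)\<^sup>2)
        = (1 - s\<^sup>2) / 2 * (\<Sum>i=1..j. A i / lam i * (w i)\<^sup>2)
          + (1 - s\<^sup>2) / 2 * (A (Suc j) / lam (Suc j) * (norm (y (Suc j) - xt j))\<^sup>2)"
      by (simp add: w_def distrib_left del: of_nat_Suc)
    with Suc.IH step[folded iter(8,9)[OF j]] j show ?case
      by linarith
  qed (simp add: A0)
  define D where "D = infdist (x 0) (minimizers F)"
  have X: "minimizers F \<noteq> {}"
    using minimizers_nonempty by (simp add: F_def)
  then obtain zs where zs: "zs \<in> minimizers F"
    by blast
  \<comment> \<open>All minimizers share one value, so the gap stays fixed while the bound is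
    optimized over \<open>z\<close>.\<close>
  have Fr_min: "Fr z = Fr zs" if "z \<in> minimizers F" for z
    unfolding Fr_def using min_le[OF that, of zs] min_le[OF zs, of z] by simp
  have Fr_le: "Fr zs \<le> Fr (y k)"
    unfolding Fr_def using min_le[OF zs, of "y k"] min_fin[OF zs] F_ninf y_fin[of "k - 1"] k
    by (cases "F zs"; cases "F (y k)") auto
  have w_sum_nonneg: "(\<Sum>i=1..k. A i / lam i * (w i)\<^sup>2) \<ge> 0"
  proof (intro sum_nonneg mult_nonneg_nonneg divide_nonneg_nonneg)
    fix i assume "i \<in> {1..k}"
    then obtain j where "i = Suc j" "j < k"
      by (cases i) auto
    then show "A i \<ge> 0" "lam i \<ge> 0"
      using A_nonneg[of i] iter(2)[of j] by auto
  qed simp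
  \<comment> \<open>Keeps the gap and discards the two other nonnegative terms of the potential;
    \<open>D_sum\<close> below keeps the weighted sum instead.\<close>
  have D_gap: "2 * (A k * (Fr (y k) - Fr zs)) \<le> D\<^sup>2"
    unfolding D_def
  proof (rule le_infdist_power2[OF X])
    fix z assume z: "z \<in> minimizers F"
    have "(1 - s\<^sup>2) / 2 * (\<Sum>i=1..k. A i / lam i * (w i)\<^sup>2) \<ge> 0"
      using s w_sum_nonneg by simp
    then show "2 * (A k * (Fr (y k) - Fr zs)) \<le> (dist (x 0) z)\<^sup>2"
      using potential[OF z order_refl, unfolded Fr_min[OF z]] zero_le_power2[of "norm (x k - z)"]
      unfolding dist_norm by linarith
  qed
  have D_sum: "(\<Sum>i=1..k. A i / lam i * (w i)\<^sup>2) \<le> D\<^sup>2 / (1 - s\<^sup>2)"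
  proof -
    have "(1 - s\<^sup>2) * (\<Sum>i=1..k. A i / lam i * (w i)\<^sup>2) \<le> D\<^sup>2"
      unfolding D_def
    proof (rule le_infdist_power2[OF X])
      fix z assume z: "z \<in> minimizers F"
      have "A k * (Fr (y k) - Fr z) \<ge> 0"
        using A_nonneg[of k] Fr_le Fr_min[OF z] by simp
      then show "(1 - s\<^sup>2) * (\<Sum>i=1..k. A i / lam i * (w i)\<^sup>2) \<le> (dist (x 0) z)\<^sup>2"
        using potential[OF z order_refl] zero_le_power2[of "norm (x k - z)"]
        unfolding dist_norm by argo
    qed
    then show ?thesis
      using s by (simp add: field_simps)
  qed
  have growth: "(2 * real k / (real d + 1)) powr ((3 * real d + 1) / 2)
      * (c * (D\<^sup>2 / (1 - s\<^sup>2)) powr (- (real d - 1) / 2)) / 2 ^ (d + 1) \<le> A k"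
  proof (rule accumulated_step_growth[OF d k c A0 _ sqrt_step _ _ D_sum])
    fix j assume "j \<in> {1..k}"
    then obtain i where i: "j = Suc i" "i < k"
      by (cases j) auto
    show "lam j > 0"
      using iter(2)[OF i(2)] i by simp
    show "c \<le> lam j * w j ^ (d - 1)"
      using large[OF i(2)] i by (simp add: large_step_def c_def w_def)
  qed (auto simp: w_def)
  have "A k > 0"
    using a_pos[of "k - 1"] A_nonneg[of "k - 1"] iter(8)[of "k - 1"] k by simp
  then have "Fr (y k) - Fr zs \<le> ((real d + 1) / 2) powr ((3 * real d + 1) / 2)
      * (2 ^ d / ((1 - s\<^sup>2) powr ((real d - 1) / 2) * c)) * D ^ (d + 1)
      * real k powr (- ((3 * real d + 1) / 2))"
    using complexity_bound_from_growth[OF d k s c _ _ growth D_gap] by (simp add: D_def infdist_nonneg)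
  also have "\<dots> = ((real d + 1) / 2) powr ((3 * real d + 1) / 2)
        * (2 ^ d / ((1 - (\<sigma> + \<sigma>\<^sub>u)\<^sup>2) powr ((real d - 1) / 2) * fact d * \<sigma>\<^sub>l))
        * infdist (x 0) (minimizers (objective f h)) ^ (d + 1)
        * (L + M) * real k powr (- ((3 * real d + 1) / 2))"
    by (simp add: c_def s_def D_def F_def mult_ac)
  finally have "ereal (Fr (y k) - Fr zs) \<le> ereal \<dots>"
    by simp
  moreover have "(INF z. objective f h z) = F zs"
    unfolding F_def[symmetric] by (rule antisym) (auto intro: INF_lower INF_greatest min_le[OF zs])
  moreover have "objective f h (y k) - F zs = ereal (Fr (y k) - Fr zs)"
    unfolding F_def[symmetric] Fr_def using y_fin[of "k - 1"] k min_fin[OF zs] F_ninf[of zs]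
    by (cases "F (y k)"; cases "F zs") auto
  ultimately show ?thesis
    by simp
qed

end
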